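(* For every $n\ge 1$, $(ATT^U)^n\cap\mathcal{F}=(dATT^U)^n$, where $(ATT^U)^n$ (respectively $(dATT^U)^n$) is the class of tree translations realizable by a composition of $n$ nondeterministic (respectively $n$ deterministic) attributed tree transducers with look-around, and $\mathcal{F}$ is the class of all (partial) functions.
   Context: Trees. A ranked alphabet $\Sigma$ is a finite set of symbols each with a unique rank $k\ge 0$; $\Sigma_k$ is the set of symbols of rank $k$; $T_\Sigma$ is the set of (finite ordered) trees over $\Sigma$, and $[k]=\{1,\dots,k\}$. Nodes are strings over $\mathbb{N}$: the root is $\epsilon$, the $i$-th child of $v$ is $v.i$; $V(t)$ is the set of nodes of $t$ and $t[v]$ the label of $v$. For a set $\Lambda$ disjoint from $\Sigma$, $T_\Sigma[\Lambda]$ is the set of trees over $\Sigma$ where elements of $\Lambda$ may also occur as leaf labels. Attributed tree transducers. An $att$ is $A=(S,I,\Sigma,\Delta,a_0,R)$ where $S,I$ are disjoint finite sets of synthesized and inherited attributes, $\Sigma,\Delta$ are ranked alphabets (input, output), $a_0\in S$ is the initial attribute, and $R=(R_\sigma\mid\sigma\in\Sigma\cup\{\#\})$ is a collection of finite rule sets, where $\#\notin\Sigma$ is a root marker of rank 1. For $\sigma\in\Sigma_k$, $R_\sigma$ contains arbitrarily many rules $a(\pi)\to\xi$ for each $a\in S$ and arbitrarily many rules $b(\pi i)\to\xi$ for each $b\in I$, $i\in[k]$, with $\xi\in T_\Delta[\{a'(\pi i)\mid a'\in S,i\in[k]\}\cup\{b'(\pi)\mid b'\in I\}]$ ($\pi$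 is a node variable). $R_\#$ is defined analogously (with $k=1$), but contains no rules with synthesized attributes on the left-hand side and no inherited attributes on right-hand sides. $A$ is deterministic (a $datt$) if each left-hand side has at most one rule in each $R_\sigma$ and in $R_\#$. Semantics. For $s\in T_\Sigma$ let $s^\#=\#(s)$ and $\mathrm{SI}(s^\#)=\{\alpha(v)\mid \alpha\in S\cup I, v\in V(s^\#)\}$. With the conventions $\pi 0=\pi$, $v.0=v$, for $t,t'\in T_\Delta[\mathrm{SI}(s^\#)]$ write $t\Rightarrow_{A,s^\#}t'$ if $t'$ arises from $t$ by replacing one leaf labeled $\gamma(v.i)$ (where $i=0$ if $\gamma\in S$, and $i>0$ if $\gamma\in I$) by $\xi[\pi\leftarrow v]$ for some rule $\gamma(\pi i)\to\xi$ in $R_{s^\#[v]}$, where $[\pi\leftarrow v]$ replaces every occurrence of $\pi$ by $v$. The translation of $A$ is $\tau_A=\{(s,t)\in T_\Sigma\times T_\Delta\mid a_0(1)\Rightarrow^*_{A,s^\#}t\}$. Circular $atts$ (where some $\alpha(v)$ derives in one or more steps a tree containing $\alpha(v)$) are allowed. Look-around. A bottom-up relabeling is $B=(P,\Sigma,\Sigma',F,R)$ with finite state set $P$, ranked alphabets $\Sigma,\Sigma'$, final states $F\subseteq P$, and for every $\sigma\in\Sigma_k$, $p_1,\dots,p_k\in P$ at most one rule $\sigma(p_1(x_1),\dots,p_k(x_k))\to p(\sigma'(x_1,\dots,x_k))$ with $p\in P$, $\sigma'\in\Sigma'_k$; it relabels trees bottom-up in the usual way and $\tau_B=\{(s,s')\mid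 s\Rightarrow_B^* p(s'),\ p\in F\}$. A top-down relabeling is a $datt$ without inherited attributes in which every rule for $\sigma\in\Sigma_k$ has the form $q(\pi)\to\sigma'(q_1(\pi1),\dots,q_k(\pi k))$ with $\sigma'$ of rank $k$. A look-around is a pair $U=(B,T)$ of a bottom-up relabeling $B$ and a top-down relabeling $T$, with $\tau_U=\tau_B\circ\tau_T$ (first $B$, then $T$). An $att$ with look-around ($att^U$) is a pair $(U,A')$ of a look-around $U$ and an $att$ $A'$, realizing $\tau_U\circ\tau_{A'}$ (first $U$, then $A'$); it is a deterministic $att^U$ ($datt^U$) if $A'$ is a $datt$. Relation composition is $\rho\circ\rho'=\{(x,z)\mid\exists y:(x,y)\in\rho,(y,z)\in\rho'\}$; the composition of $n$ $atts^U$ $A_1,\dots,A_n$ (output alphabet of $A_i$ equal to the input alphabet of $A_{i+1}$) realizes $\tau_{A_1}\circ\cdots\circ\tau_{A_n}$. A relation $\rho$ is a function if $(x,y),(x,y')\in\rho$ implies $y=y'$. *)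

theory Defs
  imports Main "HOL-Library.Infinite_Typeclass"
begin

section \<open>Ranked alphabets and trees\<close>

text \<open>A ranked alphabet is a partial map with finite domain: \<open>\<Sigma> f = Some k\<close> says that \<open>f\<close> is
  a symbol of \<open>\<Sigma>\<close> and has rank \<open>k\<close>.\<close>

type_synonym 'f alphabet = "'f \<rightharpoonup> nat"

definition ranked_alphabet :: "'f alphabet \<Rightarrow> bool" where
  "ranked_alphabet \<Sigma> \<longleftrightarrow> finite (dom \<Sigma>)"

datatype 'f tree = Node 'f "'f tree list"

text \<open>Trees in which elements of a set disjoint from the alphabet may label additional leaves;
  the disjointness is enforced by the separate constructor.\<close>

datatype ('f, 'l) ltree = Leaf 'l | Op 'f "('f, 'l) ltree list"

primrec embed :: "'f tree \<Rightarrow> ('f, 'l) ltree" where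
  "embed (Node f ts) = Op f (map embed ts)"

inductive_set trees :: "'f alphabet \<Rightarrow> 'f tree set" for \<Sigma> where
  "\<lbrakk>\<Sigma> f = Some (length ts); \<forall>t\<in>set ts. t \<in> trees \<Sigma>\<rbrakk> \<Longrightarrow> Node f ts \<in> trees \<Sigma>"

inductive_set ltrees :: "'f alphabet \<Rightarrow> 'l set \<Rightarrow> ('f, 'l) ltree set" for \<Delta> \<Lambda> where
  "l \<in> \<Lambda> \<Longrightarrow> Leaf l \<in> ltrees \<Delta> \<Lambda>"
| "\<lbrakk>\<Delta> f = Some (length ts); \<forall>t\<in>set ts. t \<in> ltrees \<Delta> \<Lambda>\<rbrakk> \<Longrightarrow> Op f ts \<in> ltrees \<Delta> \<Lambda>"

text \<open>Nodes are strings of child indices counted from 1; the result is \<open>None\<close> for a string that is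
  not a node of the tree.\<close>

fun node_label :: "'f tree \<Rightarrow> nat list \<Rightarrow> 'f option" where
  "node_label (Node f ts) [] = Some f"
| "node_label (Node f ts) (i # v) =
     (if 1 \<le> i \<and> i \<le> length ts then node_label (ts ! (i - 1)) v else None)"

definition nodes :: "'f tree \<Rightarrow> nat list set" where
  "nodes t = {v. node_label t v \<noteq> None}"

text \<open>The \<open>i\<close>-th child of \<open>v\<close>, with the convention that child \<open>0\<close> is \<open>v\<close> itself.\<close>

definition child :: "nat list \<Rightarrow> nat \<Rightarrow> nat list" where
  "child v i = (if i = 0 then v else v @ [i])"


section \<open>Attributed tree transducers\<close>

text \<open>The root marker is \<open>None\<close>, so that symbols of \<open>s\<^sup>#\<close> have type \<open>'f option\<close>.
  A rule \<open>\<gamma>(\<pi> i) \<rightarrow> \<xi>\<close> is the pair \<open>((\<gamma>, i), \<xi>)\<close>, and a leaf \<open>\<gamma>'(\<pi> j)\<close> of \<open>\<xi>\<close> is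
  \<open>Leaf (\<gamma>', j)\<close>, where \<open>\<pi> 0 = \<pi>\<close>.\<close>

record ('q, 'f, 'g) att =
  syn :: "'q set"
  inh :: "'q set"
  att_in :: "'f alphabet"
  att_out :: "'g alphabet"
  att_init :: 'q
  att_rules :: "'f option \<Rightarrow> (('q \<times> nat) \<times> ('g, 'q \<times> nat) ltree) set"

definition att :: "('q, 'f, 'g) att \<Rightarrow> bool" where
  "att A \<longleftrightarrow>
     finite (syn A) \<and> finite (inh A) \<and> syn A \<inter> inh A = {} \<and>
     ranked_alphabet (att_in A) \<and> ranked_alphabet (att_out A) \<and> att_init A \<in> syn A \<and>
     (\<forall>\<sigma> k. att_in A \<sigma> = Some k \<longrightarrow>
        finite (att_rules A (Some \<sigma>)) \<and>
        (\<forall>((\<gamma>, i), \<xi>) \<in> att_rules A (Some \<sigma>).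
           (\<gamma> \<in> syn A \<and> i = 0 \<or> \<gamma> \<in> inh A \<and> i \<in> {1..k}) \<and>
           \<xi> \<in> ltrees (att_out A) (syn A \<times> {1..k} \<union> inh A \<times> {0}))) \<and>
     finite (att_rules A None) \<and>
     (\<forall>((\<gamma>, i), \<xi>) \<in> att_rules A None.
        \<gamma> \<in> inh A \<and> i = 1 \<and> \<xi> \<in> ltrees (att_out A) (syn A \<times> {1}))"

definition deterministic :: "('q, 'f, 'g) att \<Rightarrow> bool" where
  "deterministic A \<longleftrightarrow>
     (\<forall>\<sigma> \<in> insert None (Some ` dom (att_in A)). \<forall>l \<xi> \<xi>'.
        (l, \<xi>) \<in> att_rules A \<sigma> \<and> (l, \<xi>') \<in> att_rules A \<sigma> \<longrightarrow> \<xi> = \<xi>')"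

definition datt :: "('q, 'f, 'g) att \<Rightarrow> bool" where
  "datt A \<longleftrightarrow> att A \<and> deterministic A"

definition mark :: "'f tree \<Rightarrow> 'f option tree" where
  "mark s = Node None [map_tree Some s]"

definition SI :: "('q, 'f, 'g) att \<Rightarrow> 'f option tree \<Rightarrow> ('q \<times> nat list) set" where
  "SI A s = (syn A \<union> inh A) \<times> nodes s"

text \<open>Replacement of one leaf; the trees are restricted to leaves from \<open>SI\<close> in the definition of
  \<open>att_step\<close> below.\<close>

inductive att_rewrite ::
  "('q, 'f, 'g) att \<Rightarrow> 'f option tree \<Rightarrow> ('g, 'q \<times> nat list) ltree \<Rightarrow> ('g, 'q \<times> nat list) ltree \<Rightarrow> bool"
  for A s where
  leaf: "\<lbrakk>node_label s v = Some \<sigma>; ((\<gamma>, i), \<xi>) \<in> att_rules A \<sigma>;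
          \<gamma> \<in> syn A \<and> i = 0 \<or> \<gamma> \<in> inh A \<and> i > 0\<rbrakk>
    \<Longrightarrow> att_rewrite A s (Leaf (\<gamma>, child v i)) (map_ltree id (\<lambda>(\<gamma>', j). (\<gamma>', child v j)) \<xi>)"
| inner: "att_rewrite A s t t'
    \<Longrightarrow> att_rewrite A s (Op f (ts @ t # us)) (Op f (ts @ t' # us))"

definition att_step ::
  "('q, 'f, 'g) att \<Rightarrow> 'f option tree \<Rightarrow> (('g, 'q \<times> nat list) ltree \<times> ('g, 'q \<times> nat list) ltree) set" where
  "att_step A s =
     {(t, t'). t \<in> ltrees (att_out A) (SI A s) \<and> t' \<in> ltrees (att_out A) (SI A s) \<and> att_rewrite A s t t'}"

definition att_trans :: "('q, 'f, 'g) att \<Rightarrow> ('f tree \<times> 'g tree) set" where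
  "att_trans A =
     {(s, t). s \<in> trees (att_in A) \<and> t \<in> trees (att_out A) \<and>
        (Leaf (att_init A, [1]), embed t) \<in> (att_step A (mark s))\<^sup>*}"


section \<open>Relabelings and look-around\<close>

text \<open>The rule \<open>\<sigma>(p\<^sub>1(x\<^sub>1), \<dots>, p\<^sub>k(x\<^sub>k)) \<rightarrow> p(\<sigma>'(x\<^sub>1, \<dots>, x\<^sub>k))\<close> is
  \<open>bu_rules B \<sigma> [p\<^sub>1, \<dots>, p\<^sub>k] = Some (p, \<sigma>')\<close>.\<close>

record ('p, 'f, 'g) bu =
  bu_states :: "'p set"
  bu_in :: "'f alphabet"
  bu_out :: "'g alphabet"
  bu_final :: "'p set"
  bu_rules :: "'f \<Rightarrow> 'p list \<Rightarrow> ('p \<times> 'g) option"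

definition bu_relabeling :: "('p, 'f, 'g) bu \<Rightarrow> bool" where
  "bu_relabeling B \<longleftrightarrow>
     finite (bu_states B) \<and> ranked_alphabet (bu_in B) \<and> ranked_alphabet (bu_out B) \<and>
     bu_final B \<subseteq> bu_states B \<and>
     (\<forall>\<sigma> ps p \<sigma>'. bu_rules B \<sigma> ps = Some (p, \<sigma>') \<longrightarrow>
        bu_in B \<sigma> = Some (length ps) \<and> set ps \<subseteq> bu_states B \<and>
        p \<in> bu_states B \<and> bu_out B \<sigma>' = Some (length ps))"

text \<open>\<open>bu_run B s p s'\<close> stands for \<open>s \<Rightarrow>\<^sub>B\<^sup>* p(s')\<close>.\<close>

inductive bu_run :: "('p, 'f, 'g) bu \<Rightarrow> 'f tree \<Rightarrow> 'p \<Rightarrow> 'g tree \<Rightarrow> bool" for B where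
  "\<lbrakk>length ps = length ts; length us = length ts;
    \<forall>i<length ts. bu_run B (ts ! i) (ps ! i) (us ! i);
    bu_rules B \<sigma> ps = Some (p, \<sigma>')\<rbrakk>
   \<Longrightarrow> bu_run B (Node \<sigma> ts) p (Node \<sigma>' us)"

definition bu_trans :: "('p, 'f, 'g) bu \<Rightarrow> ('f tree \<times> 'g tree) set" where
  "bu_trans B = {(s, s'). s \<in> trees (bu_in B) \<and> (\<exists>p \<in> bu_final B. bu_run B s p s')}"

definition td_relabeling :: "('q, 'f, 'g) att \<Rightarrow> bool" where
  "td_relabeling T \<longleftrightarrow>
     datt T \<and> inh T = {} \<and>
     (\<forall>\<sigma> k. att_in T \<sigma> = Some k \<longrightarrow>
        (\<forall>(l, \<xi>) \<in> att_rules T (Some \<sigma>).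
           \<exists>\<sigma>' qs. att_out T \<sigma>' = Some k \<and> length qs = k \<and>
             \<xi> = Op \<sigma>' (map (\<lambda>i. Leaf (qs ! i, Suc i)) [0..<k])))"

record ('p, 'q, 'f, 'g, 'h) lookaround =
  la_bu :: "('p, 'f, 'g) bu"
  la_td :: "('q, 'g, 'h) att"

definition lookaround :: "('p, 'q, 'f, 'g, 'h) lookaround \<Rightarrow> bool" where
  "lookaround U \<longleftrightarrow>
     bu_relabeling (la_bu U) \<and> td_relabeling (la_td U) \<and> bu_out (la_bu U) = att_in (la_td U)"

definition la_trans :: "('p, 'q, 'f, 'g, 'h) lookaround \<Rightarrow> ('f tree \<times> 'h tree) set" where
  "la_trans U = bu_trans (la_bu U) O att_trans (la_td U)"


section \<open>Transducers with look-around and their compositions\<close>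

text \<open>States and attributes are taken from \<open>nat\<close> and all symbols from one type \<open>'a\<close>. As state sets,
  attribute sets and alphabets are finite, this is no restriction for infinite \<open>'a\<close>.\<close>

record 'a attU =
  attU_la :: "(nat, nat, 'a, 'a, 'a) lookaround"
  attU_att :: "(nat, 'a, 'a) att"

definition attU :: "'a attU \<Rightarrow> bool" where
  "attU M \<longleftrightarrow>
     lookaround (attU_la M) \<and> att (attU_att M) \<and> att_out (la_td (attU_la M)) = att_in (attU_att M)"

definition dattU :: "'a attU \<Rightarrow> bool" where
  "dattU M \<longleftrightarrow> attU M \<and> deterministic (attU_att M)"

definition attU_in :: "'a attU \<Rightarrow> 'a alphabet" where
  "attU_in M = bu_in (la_bu (attU_la M))"

definition attU_out :: "'a attU \<Rightarrow> 'a alphabet" where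
  "attU_out M = att_out (attU_att M)"

definition attU_trans :: "'a attU \<Rightarrow> ('a tree \<times> 'a tree) set" where
  "attU_trans M = la_trans (attU_la M) O att_trans (attU_att M)"

definition composable :: "'a attU list \<Rightarrow> bool" where
  "composable Ms \<longleftrightarrow> (\<forall>i. Suc i < length Ms \<longrightarrow> attU_out (Ms ! i) = attU_in (Ms ! Suc i))"

definition compose_trans :: "'a attU list \<Rightarrow> ('a tree \<times> 'a tree) set" where
  "compose_trans Ms = foldr (\<lambda>M \<rho>. attU_trans M O \<rho>) Ms Id"

definition ATTU_pow :: "nat \<Rightarrow> ('a tree \<times> 'a tree) set set" where
  "ATTU_pow n = {compose_trans Ms | Ms. length Ms = n \<and> (\<forall>M \<in> set Ms. attU M) \<and> composable Ms}"

definition dATTU_pow :: "nat \<Rightarrow> ('a tree \<times> 'a tree) set set" where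
  "dATTU_pow n = {compose_trans Ms | Ms. length Ms = n \<and> (\<forall>M \<in> set Ms. dattU M) \<and> composable Ms}"

definition partial_functions :: "('a tree \<times> 'a tree) set set" where
  "partial_functions = {\<rho>. single_valued \<rho>}"

end

theory Submission
  imports Defs "HOL-Library.Countable"
begin

text \<open>A composition of deterministic transducers with look-around is functional because each factor
  is. Conversely, every \<open>att\<^sup>U\<close> \<open>M\<close> and recognizable language \<open>L\<close> admit a \<open>datt\<^sup>U\<close> whose
  translation is contained in that of \<open>M\<close>, has its range in \<open>L\<close> and is defined on all of
  \<open>M\<inverse>(L)\<close>, a recognizable language again. Uniformizing the factors from the last to the first, each
  with range in the domain of the composition of its successors, yields a uniformizer of the whole
  composition; if the composition is functional, the two coincide.

  To uniformize a single factor, read an \<open>att\<close> on a fixed input tree as a regular tree grammar whose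
  nonterminals are the attribute instances. Choosing for each productive nonterminal a rule of
  minimal derivation height makes the grammar deterministic and keeps the productive nonterminals
  productive. The chosen rules are written into the labels of the input tree. The trees on which the
  resulting \<open>datt\<close> is defined form a recognizable language, so a good labeling can be guessed by a
  nondeterministic finite-state relabeling, and such a relabeling is uniformized by a look-around.\<close>

text \<open>A derivation may rewrite two occurrences of one attribute instance by different rules,
  even along a cycle, so it does not determine a rule per instance; hence the uniform choice on the
  whole grammar before anything is recorded in labels. That choice preserves the existence of an
  output but not a prescribed output, so membership in the target language has to be secured
  beforehand, by splitting each attribute according to the class of the tree it derives. The start
  attribute thereby becomes a choice as well. The root marker is added by the semantics and lies
  outside the input alphabet, so no relabeling reaches it; the choice for it has to travel inside
  the attributes. Finally, the factors of a functional composition need not be functional, so they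
  cannot be replaced by equivalent deterministic ones; what is controlled instead is the range of
  each uniformizer.\<close>

section \<open>Trees with additional leaves\<close>

text \<open>Equal to \<open>map_ltree id\<close> (\<open>map_ltree_id\<close>), but without the
  symbol map, so that inductions and rewriting see only the leaves.\<close>

primrec lmap :: "('x \<Rightarrow> 'y) \<Rightarrow> ('f, 'x) ltree \<Rightarrow> ('f, 'y) ltree" where
  "lmap g (Leaf x) = Leaf (g x)"
| "lmap g (Op f xs) = Op f (map (lmap g) xs)"

lemma map_ltree_id: "map_ltree id g \<xi> = lmap g \<xi>"
  by (induction \<xi>) auto

lemma lmap_lmap: "lmap f (lmap g \<xi>) = lmap (\<lambda>x. f (g x)) \<xi>"
  by (induction \<xi>) auto

lemma lmap_cong: "(\<And>x. x \<in> set2_ltree \<xi> \<Longrightarrow> f x = g x) \<Longrightarrow> lmap f \<xi> = lmap g \<xi>"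
  by (induction \<xi>) auto

lemma set2_lmap [simp]: "set2_ltree (lmap g \<xi>) = g ` set2_ltree \<xi>"
  by (induction \<xi>) auto

text \<open>Substitution with an independent choice per leaf occurrence: two occurrences of the same
  leaf may receive different trees. This matches rewriting, where each occurrence of an attribute
  instance is rewritten separately.\<close>

inductive deval :: "('x \<Rightarrow> 'f tree \<Rightarrow> bool) \<Rightarrow> ('f, 'x) ltree \<Rightarrow> 'f tree \<Rightarrow> bool" for E where
  Leaf: "E x t \<Longrightarrow> deval E (Leaf x) t"
| Op: "list_all2 (deval E) xs ts \<Longrightarrow> deval E (Op f xs) (Node f ts)"

inductive_cases deval_LeafE: "deval E (Leaf x) t"
inductive_cases deval_OpE: "deval E (Op f xs) t"

lemma deval_Leaf_iff [simp]: "deval E (Leaf x) t \<longleftrightarrow> E x t"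
  by (auto intro: deval.Leaf elim: deval_LeafE)

lemma deval_Op_iff: "deval E (Op f xs) t \<longleftrightarrow> (\<exists>ts. t = Node f ts \<and> list_all2 (deval E) xs ts)"
  by (auto intro: deval.Op elim: deval_OpE)

lemma deval_cong_leaves:
  "deval E \<xi> t \<Longrightarrow> (\<And>x u. x \<in> set2_ltree \<xi> \<Longrightarrow> E x u \<Longrightarrow> E' x u) \<Longrightarrow> deval E' \<xi> t"
proof (induction \<xi> arbitrary: t)
  case (Op f xs)
  then obtain ts where "t = Node f ts" "list_all2 (deval E) xs ts"
    by (auto simp: deval_Op_iff)
  moreover have "deval E' x u" if "x \<in> set xs" "deval E x u" for x u
    using that Op.prems(2) by (intro Op.IH) auto
  with calculation have "list_all2 (deval E') xs ts" by (auto elim!: list.rel_mono_strong)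
  ultimately show ?case by (auto simp: deval_Op_iff)
qed auto

text \<open>Registered with \<open>mono\<close> so that \<open>gder\<close> may occur below
  \<open>deval\<close> in its own inductive definition.\<close>

lemma deval_mono [mono]:
  "(\<And>x t. E x t \<longrightarrow> E' x t) \<Longrightarrow> deval E \<xi> t \<longrightarrow> deval E' \<xi> t"
  by (auto intro: deval_cong_leaves)

lemma deval_map: "deval E (lmap g \<xi>) t \<longleftrightarrow> deval (\<lambda>x. E (g x)) \<xi> t"
proof (induction \<xi> arbitrary: t)
  case (Op f xs)
  have "list_all2 (deval E) (map (lmap g) xs) ts \<longleftrightarrow> list_all2 (deval (\<lambda>x. E (g x))) xs ts" for ts
    using Op by (auto simp: list_all2_conv_all_nth)
  then show ?case by (simp add: deval_Op_iff)
qed auto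

lemma deval_ex: "(\<And>x. x \<in> set2_ltree \<xi> \<Longrightarrow> \<exists>t. E x t) \<Longrightarrow> \<exists>t. deval E \<xi> t"
proof (induction \<xi>)
  case (Op f xs)
  then have "\<forall>i<length xs. \<exists>t. deval E (xs ! i) t"
    by (metis UN_I ltree.set(4) nth_mem)
  then obtain T where "\<forall>i<length xs. deval E (xs ! i) (T i)" by metis
  then have "deval E (Op f xs) (Node f (map T [0..<length xs]))"
    by (auto simp: deval_Op_iff list_all2_conv_all_nth)
  then show ?case ..
qed auto

lemma deval_leaves: "deval E \<xi> t \<Longrightarrow> x \<in> set2_ltree \<xi> \<Longrightarrow> \<exists>u. E x u"
proof (induction \<xi> arbitrary: t)
  case (Op f xs)
  then obtain y where y: "y \<in> set xs" "x \<in> set2_ltree y" by auto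
  with Op.prems(1) obtain u where "deval E y u"
    by (auto simp: deval_Op_iff list_all2_conv_all_nth in_set_conv_nth)
  with y Op.IH show ?case by blast
qed auto

text \<open>The first premise has the shape of the induction hypothesis that rule induction on
  \<open>gder\<close> provides in \<open>gder_unique\<close>.\<close>

lemma deval_unique:
  "deval (\<lambda>x t. E x t \<and> (\<forall>t'. E' x t' \<longrightarrow> t = t')) \<xi> t \<Longrightarrow> deval E' \<xi> t' \<Longrightarrow> t = t'"
proof (induction \<xi> arbitrary: t t')
  case (Op f xs)
  from Op.prems obtain us us' where us: "t = Node f us" "t' = Node f us'"
    "list_all2 (deval (\<lambda>x t. E x t \<and> (\<forall>t'. E' x t' \<longrightarrow> t = t'))) xs us" "list_all2 (deval E') xs us'"
    by (auto simp: deval_Op_iff)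
  have "us ! i = us' ! i" if "i < length xs" for i
    using us(3,4) that by (intro Op.IH[OF nth_mem]) (auto simp: list_all2_conv_all_nth)
  moreover have "length us = length xs" "length us' = length xs" using us(3,4) by (auto dest: list_all2_lengthD)
  ultimately show ?case using us(1,2) by (auto intro!: nth_equalityI)
qed auto

lemma deval_trees:
  assumes "\<xi> \<in> ltrees \<Delta> \<Lambda>" "deval E \<xi> t" "\<And>x t. E x t \<Longrightarrow> t \<in> trees \<Delta>"
  shows "t \<in> trees \<Delta>"
  using assms(1,2)
proof (induction arbitrary: t)
  case (2 f ts)
  then obtain us where us: "t = Node f us" "list_all2 (deval E) ts us"
    by (auto simp: deval_Op_iff)
  have "\<forall>u\<in>set us. u \<in> trees \<Delta>"
    using us(2) 2 by (metis in_set_conv_nth list_all2_conv_all_nth)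
  with us 2 show ?case by (auto intro!: trees.intros simp: list_all2_lengthD)
qed (use assms(3) in auto)

lemma ltrees_map: "\<xi> \<in> ltrees \<Delta> \<Lambda> \<Longrightarrow> g ` \<Lambda> \<subseteq> \<Lambda>' \<Longrightarrow> lmap g \<xi> \<in> ltrees \<Delta> \<Lambda>'"
  by (induction rule: ltrees.induct) (auto intro!: ltrees.intros)

lemma ltrees_mono: "\<xi> \<in> ltrees \<Delta> \<Lambda> \<Longrightarrow> \<Lambda> \<subseteq> \<Lambda>' \<Longrightarrow> \<xi> \<in> ltrees \<Delta> \<Lambda>'"
  by (induction rule: ltrees.induct) (auto intro!: ltrees.intros)

lemma ltrees_leaves: "\<xi> \<in> ltrees \<Delta> \<Lambda> \<Longrightarrow> set2_ltree \<xi> \<subseteq> \<Lambda>"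
  by (induction rule: ltrees.induct) auto

lemma finite_leaves: "finite (set2_ltree \<xi>)"
  by (induction \<xi>) auto

lemma ltrees_unmap:
  "lmap g \<xi> \<in> ltrees \<Delta> \<Lambda> \<Longrightarrow> set2_ltree \<xi> \<subseteq> \<Lambda>' \<Longrightarrow> \<xi> \<in> ltrees \<Delta> \<Lambda>'"
proof (induction \<xi>)
  case (Op f xs)
  from Op.prems(1) show ?case
  proof (cases rule: ltrees.cases)
    case (2 f' ts)
    then have "lmap g x \<in> ltrees \<Delta> \<Lambda>" if "x \<in> set xs" for x using that by auto
    then have "\<forall>x\<in>set xs. x \<in> ltrees \<Delta> \<Lambda>'" using Op.IH Op.prems(2) by fastforce
    with 2 show ?thesis by (auto intro: ltrees.intros)
  qed auto
qed (auto intro: ltrees.intros)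

section \<open>Derivations of a grammar\<close>

type_synonym ('f, 'x) grammar = "('x \<times> ('f, 'x) ltree) set"

inductive gder :: "('f, 'x) grammar \<Rightarrow> 'x \<Rightarrow> 'f tree \<Rightarrow> bool" for G where
  "(x, \<zeta>) \<in> G \<Longrightarrow> deval (gder G) \<zeta> t \<Longrightarrow> gder G x t"

inductive_cases gderE: "gder G x t"

text \<open>The simulation principle behind the renaming of attributes and both directions of the
  choice construction. No injectivity is asked for, so \<open>\<phi>\<close> may also forget
  information.\<close>

lemma gder_map:
  assumes "\<And>x \<zeta>. (x, \<zeta>) \<in> G \<Longrightarrow> (\<phi> x, lmap \<phi> \<zeta>) \<in> G'"
  shows "gder G x t \<Longrightarrow> gder G' (\<phi> x) t"
proof (induction rule: gder.induct)
  case (1 x \<zeta> t)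
  then show ?case
    by (intro gder.intros[OF assms]) (auto simp: deval_map intro: deval_cong_leaves)
qed

text \<open>Derivations are finite, so even circular rules cause no ambiguity as long as each
  nonterminal has at most one rule.\<close>

lemma gder_unique:
  assumes "single_valued G"
  shows "gder G x t \<Longrightarrow> gder G x t' \<Longrightarrow> t = t'"
proof (induction arbitrary: t' rule: gder.induct)
  case (1 x \<zeta> t)
  from 1(3) obtain \<zeta>' where "(x, \<zeta>') \<in> G" "deval (gder G) \<zeta>' t'" by (auto elim: gderE)
  with 1 assms have "deval (gder G) \<zeta> t'" by (auto dest: single_valuedD)
  with 1(2) show ?case by (rule deval_unique)
qed

text \<open>The index bounds the height of a derivation. Leaves must have strictly smaller indices,
  so a rule without leaves is available at every index, including 0.\<close>

inductive productive :: "('f, 'x) grammar \<Rightarrow> nat \<Rightarrow> 'x \<Rightarrow> bool" for G where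
  "(x, \<zeta>) \<in> G \<Longrightarrow> \<forall>y\<in>set2_ltree \<zeta>. \<exists>m<n. productive G m y \<Longrightarrow> productive G n x"

lemma gder_imp_productive: "gder G x t \<Longrightarrow> \<exists>n. productive G n x"
proof (induction rule: gder.induct)
  case (1 x \<zeta> t)
  then have "\<forall>y\<in>set2_ltree \<zeta>. \<exists>m. productive G m y"
    using deval_leaves[OF 1(2)] by blast
  then obtain m where m: "\<forall>y\<in>set2_ltree \<zeta>. productive G (m y) y" by metis
  have "m y < Suc (Max (m ` set2_ltree \<zeta>))" if "y \<in> set2_ltree \<zeta>" for y
    using that by (simp add: finite_leaves le_imp_less_Suc)
  with m have "productive G (Suc (Max (m ` set2_ltree \<zeta>))) x"
    by (intro productive.intros[OF 1(1)]) auto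
  then show ?case ..
qed

text \<open>Choosing for every nonterminal a rule that minimizes the derivation height cannot create a
  cycle among the chosen rules.\<close>

lemma grammar_uniformization:
  obtains C where "C \<subseteq> G" "single_valued C" "\<And>x t. gder G x t \<Longrightarrow> \<exists>t'. gder C x t'"
proof -
  define P where "P x \<longleftrightarrow> (\<exists>n. productive G n x)" for x
  define ht where "ht x = (LEAST n. productive G n x)" for x
  \<comment> \<open>A rule that justifies the least bound of \<open>x\<close> has only leaves whose
    own least bounds are smaller.\<close>
  have ex: "\<exists>\<zeta>. (x, \<zeta>) \<in> G \<and> (\<forall>y\<in>set2_ltree \<zeta>. P y \<and> ht y < ht x)" if "P x" for x
  proof -
    from that have "productive G (ht x) x" unfolding P_def ht_def by (metis LeastI)
    then obtain \<zeta> where \<zeta>: "(x, \<zeta>) \<in> G" "\<forall>y\<in>set2_ltree \<zeta>. \<exists>m<ht x. productive G m y"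
      by (auto elim: productive.cases)
    then show ?thesis unfolding P_def ht_def by (metis Least_le order.strict_trans1)
  qed
  then obtain \<rho> where \<rho>: "\<And>x. P x \<Longrightarrow> (x, \<rho> x) \<in> G \<and> (\<forall>y\<in>set2_ltree (\<rho> x). P y \<and> ht y < ht x)"
    by metis
  define C where "C = {(x, \<rho> x) | x. P x}"
  \<comment> \<open>The chosen rules strictly decrease \<open>ht\<close>, so unfolding them
    terminates.\<close>
  have der: "P x \<Longrightarrow> \<exists>t. gder C x t" for x
  proof (induction "ht x" arbitrary: x rule: less_induct)
    case less
    then have "\<exists>t. deval (gder C) (\<rho> x) t" using \<rho>[OF less(2)] by (intro deval_ex) auto
    then show ?case using less(2) by (auto simp: C_def intro: gder.intros)
  qed
  show thesis
  proof
    show "C \<subseteq> G" "single_valued C" using \<rho> by (auto simp: C_def single_valued_def)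
    show "\<exists>t'. gder C x t'" if "gder G x t" for x t
      using der gder_imp_productive[OF that] by (simp add: P_def)
  qed
qed

section \<open>The grammar of an attributed tree transducer on an input tree\<close>

text \<open>Each node contributes its own instances of the rules of its label. Since
  \<open>child v 0 = v\<close>, one formula covers synthesized attributes at \<open>v\<close> and
  inherited attributes at its children; the side condition is that of
  \<open>att_rewrite\<close>.\<close>

definition ground :: "('q, 'f, 'g) att \<Rightarrow> 'f option tree \<Rightarrow> ('g, 'q \<times> nat list) grammar" where
  "ground A s = {((\<gamma>, child v i), lmap (\<lambda>(\<gamma>', j). (\<gamma>', child v j)) \<xi>) | v \<sigma> \<gamma> i \<xi>.
     node_label s v = Some \<sigma> \<and> ((\<gamma>, i), \<xi>) \<in> att_rules A \<sigma> \<and>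
     (\<gamma> \<in> syn A \<and> i = 0 \<or> \<gamma> \<in> inh A \<and> i > 0)}"

lemma groundI:
  assumes "node_label s v = Some \<sigma>" "((\<gamma>, i), \<xi>) \<in> att_rules A \<sigma>"
    "\<gamma> \<in> syn A \<and> i = 0 \<or> \<gamma> \<in> inh A \<and> i > 0"
    "x = (\<gamma>, child v i)" "\<zeta> = lmap (\<lambda>(\<gamma>', j). (\<gamma>', child v j)) \<xi>"
  shows "(x, \<zeta>) \<in> ground A s"
  using assms unfolding ground_def by blast

lemma groundE:
  assumes "(x, \<zeta>) \<in> ground A s"
  obtains v \<sigma> \<gamma> i \<xi> where "node_label s v = Some \<sigma>" "((\<gamma>, i), \<xi>) \<in> att_rules A \<sigma>"
    "\<gamma> \<in> syn A \<and> i = 0 \<or> \<gamma> \<in> inh A \<and> i > 0"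
    "x = (\<gamma>, child v i)" "\<zeta> = lmap (\<lambda>(\<gamma>', j). (\<gamma>', child v j)) \<xi>"
  using assms unfolding ground_def by blast

section \<open>Well-ranked instances and derived trees\<close>

definition marked :: "'f alphabet \<Rightarrow> 'f option alphabet" where
  "marked \<Sigma> x = (case x of None \<Rightarrow> Some 1 | Some f \<Rightarrow> \<Sigma> f)"

lemma map_tree_trees:
  "s \<in> trees \<Sigma> \<Longrightarrow> (\<And>f k. \<Sigma> f = Some k \<Longrightarrow> \<Sigma>' (g f) = Some k) \<Longrightarrow> map_tree g s \<in> trees \<Sigma>'"
  by (induction rule: trees.induct) (auto intro!: trees.intros)

lemma mark_trees: "s \<in> trees \<Sigma> \<Longrightarrow> mark s \<in> trees (marked \<Sigma>)"
  unfolding mark_def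
  by (intro trees.intros) (auto simp: marked_def intro!: map_tree_trees)

lemma trees_Node_iff: "Node f ts \<in> trees \<Sigma> \<longleftrightarrow> \<Sigma> f = Some (length ts) \<and> (\<forall>t\<in>set ts. t \<in> trees \<Sigma>)"
  by (auto intro: trees.intros elim: trees.cases)

lemma node_label_Nil [simp]: "node_label s [] = Some (case s of Node f ts \<Rightarrow> f)"
  by (cases s) auto

lemma trees_node_label:
  assumes "s \<in> trees \<Sigma>" "node_label s v = Some \<sigma>"
  shows "\<exists>k. \<Sigma> \<sigma> = Some k \<and> (\<forall>j\<in>{1..k}. v @ [j] \<in> nodes s)"
  using assms
proof (induction s v rule: node_label.induct)
  case (1 f ts)
  then show ?case by (auto simp: trees_Node_iff nodes_def)
next
  case (2 f ts i v)
  then show ?case by (auto simp: trees_Node_iff nodes_def split: if_splits)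
qed

lemma node_label_mark_Cons:
  "node_label (mark s) v = Some (Some f) \<longleftrightarrow> (\<exists>w. v = 1 # w \<and> node_label s w = Some f)"
proof -
  have *: "node_label (map_tree g s) w = map_option g (node_label s w)" for g :: "'a \<Rightarrow> 'a option" and s w
    by (induction s w rule: node_label.induct) auto
  show ?thesis by (cases v) (auto simp: mark_def *)
qed

lemma att_ruleD:
  assumes "att A" "marked (att_in A) \<sigma> = Some k" "((\<gamma>, i), \<xi>) \<in> att_rules A \<sigma>"
  shows "\<gamma> \<in> syn A \<and> i = 0 \<or> \<gamma> \<in> inh A \<and> i \<in> {1..k}"
    "\<xi> \<in> ltrees (att_out A) (syn A \<times> {1..k} \<union> inh A \<times> {0})"
proof -
  have "(\<gamma> \<in> syn A \<and> i = 0 \<or> \<gamma> \<in> inh A \<and> i \<in> {1..k}) \<and>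
    \<xi> \<in> ltrees (att_out A) (syn A \<times> {1..k} \<union> inh A \<times> {0})"
  proof (cases \<sigma>)
    case None
    with assms have "\<gamma> \<in> inh A \<and> i = 1 \<and> \<xi> \<in> ltrees (att_out A) (syn A \<times> {1})" "k = 1"
      unfolding att_def by (auto simp: marked_def split: prod.splits)
    then show ?thesis by (auto elim: ltrees_mono)
  next
    case (Some f)
    then show ?thesis using assms unfolding att_def by (fastforce simp: marked_def)
  qed
  then show "\<gamma> \<in> syn A \<and> i = 0 \<or> \<gamma> \<in> inh A \<and> i \<in> {1..k}"
    "\<xi> \<in> ltrees (att_out A) (syn A \<times> {1..k} \<union> inh A \<times> {0})" by auto
qed

lemma ground_ltrees:
  assumes "att A" "s \<in> trees (att_in A)" "(x, \<zeta>) \<in> ground A (mark s)"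
  shows "\<zeta> \<in> ltrees (att_out A) (SI A (mark s))"
  using assms(3)
proof (cases rule: groundE)
  case (1 v \<sigma> \<gamma> i \<xi>)
  from trees_node_label[OF mark_trees[OF assms(2)] 1(1)] obtain k where
    k: "marked (att_in A) \<sigma> = Some k" "\<forall>j\<in>{1..k}. v @ [j] \<in> nodes (mark s)" by blast
  moreover have "v \<in> nodes (mark s)" using 1 by (simp add: nodes_def)
  ultimately show ?thesis unfolding 1
    by (intro ltrees_map[OF att_ruleD(2)[OF assms(1) k(1) 1(2)]]) (auto simp: SI_def child_def)
qed

lemma gder_trees:
  assumes "att A" "s \<in> trees (att_in A)"
  shows "gder (ground A (mark s)) x t \<Longrightarrow> t \<in> trees (att_out A)"
proof (induction rule: gder.induct)
  case (1 x \<zeta> t)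
  then show ?case using ground_ltrees[OF assms 1(1)] by (auto intro: deval_trees)
qed

section \<open>Agreement of rewriting with grammar derivations\<close>

lemma att_rewrite_ltrees:
  assumes "att A" "s \<in> trees (att_in A)"
  shows "att_rewrite A (mark s) \<zeta> \<zeta>' \<Longrightarrow> \<zeta> \<in> ltrees (att_out A) (SI A (mark s)) \<Longrightarrow>
    \<zeta>' \<in> ltrees (att_out A) (SI A (mark s))"
proof (induction rule: att_rewrite.induct)
  case (leaf v \<sigma> \<gamma> i \<xi>)
  then show ?case by (intro ground_ltrees[OF assms groundI]) (auto simp: map_ltree_id)
next
  case (inner t t' f ts us)
  then show ?case by (auto elim!: ltrees.cases intro!: ltrees.intros)
qed

text \<open>Pulls evaluation back along one step; starting from \<open>embed t\<close>, which
  evaluates to \<open>t\<close>, a whole rewrite sequence is thus read backwards.\<close>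

lemma att_rewrite_deval:
  "att_rewrite A s \<zeta> \<zeta>' \<Longrightarrow> deval (gder (ground A s)) \<zeta>' t \<Longrightarrow> deval (gder (ground A s)) \<zeta> t"
proof (induction arbitrary: t rule: att_rewrite.induct)
  case (leaf v \<sigma> \<gamma> i \<xi>)
  then show ?case by (auto simp: map_ltree_id intro!: gder.intros groundI)
next
  case (inner t t' f ts us)
  then show ?case by (fastforce simp: deval_Op_iff list_all2_append1 list_all2_Cons1)
qed

lemma deval_embed: "deval E (embed t) t"
  by (induction t) (auto simp: deval_Op_iff list_all2_conv_all_nth)

lemma deval_derives:
  assumes "deval (\<lambda>x t. (Leaf x, embed t) \<in> {(x, y). att_rewrite A s x y}\<^sup>*) \<zeta> t"
  shows "(\<zeta>, embed t) \<in> {(x, y). att_rewrite A s x y}\<^sup>*"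
proof -
  let ?R = "{(x, y). att_rewrite A s x y}\<^sup>*"
  have ctxt: "(x, y) \<in> ?R \<Longrightarrow> (Op f (ts @ x # us), Op f (ts @ y # us)) \<in> ?R" for x y f ts us
    by (induction rule: rtrancl_induct)
       (auto intro: att_rewrite.inner rtrancl_into_rtrancl[OF _ CollectI])
  \<comment> \<open>The prefix \<open>us\<close> holds the arguments that are already rewritten; the
    others follow from left to right.\<close>
  have args: "list_all2 (\<lambda>x y. (x, y) \<in> ?R) xs ys \<Longrightarrow> (Op f (us @ xs), Op f (us @ ys)) \<in> ?R"
    for f us xs ys
  proof (induction arbitrary: us rule: list_all2_induct)
    case (Cons x xs y ys)
    have "(Op f (us @ x # xs), Op f (us @ y # xs)) \<in> ?R" by (rule ctxt) fact
    also have "(Op f (us @ y # xs), Op f (us @ y # ys)) \<in> ?R" using Cons(3)[of "us @ [y]"] by simp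
    finally show ?case .
  qed auto
  show ?thesis using assms
  proof (induction \<zeta> arbitrary: t)
    case (Op f xs)
    then obtain ts where ts: "t = Node f ts"
      "list_all2 (deval (\<lambda>x t. (Leaf x, embed t) \<in> ?R)) xs ts" by (auto simp: deval_Op_iff)
    then have "list_all2 (\<lambda>x y. (x, y) \<in> ?R) xs (map embed ts)"
      using Op(1) by (auto simp: list_all2_conv_all_nth)
    with args[of xs "map embed ts" f "[]"] ts show ?case by simp
  qed auto
qed

lemma gder_derives: "gder (ground A s) x t \<Longrightarrow> (Leaf x, embed t) \<in> {(x, y). att_rewrite A s x y}\<^sup>*"
proof (induction rule: gder.induct)
  case (1 x \<zeta> t)
  from 1(1) have "att_rewrite A s (Leaf x) \<zeta>" by (auto elim!: groundE simp flip: map_ltree_id intro: att_rewrite.leaf)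
  moreover have "(\<zeta>, embed t) \<in> {(x, y). att_rewrite A s x y}\<^sup>*"
    using 1(2) by (intro deval_derives) (auto intro: deval_cong_leaves)
  ultimately show ?case by (auto intro: converse_rtrancl_into_rtrancl)
qed

text \<open>Replaces small-step rewriting by derivation trees from here on. Compared with
  \<open>att_rewrite\<close>, \<open>att_step\<close> adds only the restriction on leaves, which
  rewriting preserves from a well-formed start.\<close>

lemma att_trans_iff:
  assumes "att A"
  shows "(s, t) \<in> att_trans A \<longleftrightarrow> s \<in> trees (att_in A) \<and> gder (ground A (mark s)) (att_init A, [1]) t"
proof (intro iffI)
  assume L: "(s, t) \<in> att_trans A"
  then have *: "(Leaf (att_init A, [1]), embed t) \<in> (att_step A (mark s))\<^sup>*" "s \<in> trees (att_in A)"
    by (auto simp: att_trans_def)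
  from *(1) have "deval (gder (ground A (mark s))) (Leaf (att_init A, [1])) t"
    by (induction rule: converse_rtrancl_induct)
       (auto simp: deval_embed att_step_def intro: att_rewrite_deval)
  with * show "s \<in> trees (att_in A) \<and> gder (ground A (mark s)) (att_init A, [1]) t" by simp
next
  assume R: "s \<in> trees (att_in A) \<and> gder (ground A (mark s)) (att_init A, [1]) t"
  let ?L = "ltrees (att_out A) (SI A (mark s))"
  have step: "(x, y) \<in> {(x, y). att_rewrite A (mark s) x y}\<^sup>* \<Longrightarrow> x \<in> ?L \<Longrightarrow>
    (x, y) \<in> (att_step A (mark s))\<^sup>* \<and> y \<in> ?L" for x y
    by (induction rule: rtrancl_induct)
       (use R assms in \<open>auto simp: att_step_def intro: att_rewrite_ltrees rtrancl_into_rtrancl\<close>)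
  have "att_init A \<in> syn A" using assms by (auto simp: att_def)
  then have "Leaf (att_init A, [1]) \<in> ?L"
    by (auto intro!: ltrees.intros simp: SI_def nodes_def mark_def)
  with step gder_derives R have "(Leaf (att_init A, [1]), embed t) \<in> (att_step A (mark s))\<^sup>*" by blast
  with R gder_trees assms show "(s, t) \<in> att_trans A" by (auto simp: att_trans_def)
qed

lemma child_inj: "child v i = child v j \<longleftrightarrow> i = j"
  by (auto simp: child_def)

lemma ground_single_valued:
  assumes "datt A" "s \<in> trees (att_in A)"
  shows "single_valued (ground A (mark s))"
proof (rule single_valuedI)
  fix x \<zeta> \<zeta>' assume *: "(x, \<zeta>) \<in> ground A (mark s)" "(x, \<zeta>') \<in> ground A (mark s)"
  from assms have A: "att A" "deterministic A" "syn A \<inter> inh A = {}"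
    by (auto simp: datt_def att_def)
  from *(1) show "\<zeta> = \<zeta>'"
  proof (cases rule: groundE)
    case 1: (1 v \<sigma> \<gamma> i \<xi>)
    from *(2) show ?thesis
    proof (cases rule: groundE)
      case 2: (1 v' \<sigma>' \<gamma>' i' \<xi>')
      \<comment> \<open>An instance at a node could stem from a synthesized attribute of that node
        or from an inherited one defined at its parent. Disjointness of the attribute sets decides
        which, and thereby fixes the node and the child index.\<close>
      have eq: "\<gamma>' = \<gamma>" "v' = v" "i' = i" using 1 2 A(3) by (auto simp: child_def split: if_splits)
      from trees_node_label[OF mark_trees[OF assms(2)] 1(1)]
      have "\<sigma> \<in> insert None (Some ` dom (att_in A))"
        by (cases \<sigma>) (auto simp: marked_def)
      with A(2) 1 2 eq have "\<xi> = \<xi>'" unfolding deterministic_def by (metis option.inject)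
      with 1 2 eq show ?thesis by simp
    qed
  qed
qed

lemma datt_single_valued: "datt A \<Longrightarrow> single_valued (att_trans A)"
  by (rule single_valuedI) (metis att_trans_iff datt_def gder_unique ground_single_valued)


section \<open>Recognizable tree languages\<close>

text \<open>A language is recognizable iff it is saturated by a congruence of finite index on all trees;
  the congruence is given by a map \<open>h\<close> whose values play the role of the states of a total
  deterministic bottom-up automaton.\<close>

definition tree_congruence :: "('f tree \<Rightarrow> 's) \<Rightarrow> bool" where
  "tree_congruence h \<longleftrightarrow> finite (range h) \<and>
     (\<forall>f ts ts'. map h ts = map h ts' \<longrightarrow> h (Node f ts) = h (Node f ts'))"

definition saturates :: "('f tree \<Rightarrow> 's) \<Rightarrow> 'f tree set \<Rightarrow> bool" where
  "saturates h L \<longleftrightarrow> (\<forall>s s'. h s = h s' \<longrightarrow> s \<in> L \<longrightarrow> s' \<in> L)"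

definition recognizable :: "'f tree set \<Rightarrow> bool" where
  "recognizable L \<longleftrightarrow> (\<exists>h :: 'f tree \<Rightarrow> nat. tree_congruence h \<and> saturates h L)"

text \<open>Finitely many classes can be numbered, which lets \<open>recognizable\<close> quantify
  over \<open>nat\<close>-valued maps only although the constructions produce states of various
  types.\<close>

lemma tree_congruence_encode:
  fixes h :: "'f tree \<Rightarrow> 's"
  assumes "tree_congruence h"
  obtains k :: "'f tree \<Rightarrow> nat" where "tree_congruence k" "\<And>s s'. k s = k s' \<longleftrightarrow> h s = h s'"
proof -
  from assms have "finite (range h)" by (simp add: tree_congruence_def)
  from finite_imp_inj_to_nat_seg[OF this] obtain e :: "'s \<Rightarrow> nat" where e: "inj_on e (range h)"
    by auto
  have eq: "e (h s) = e (h s') \<longleftrightarrow> h s = h s'" for s s' using e by (auto dest: inj_onD)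
  have "(e \<circ> h) (Node f ts) = (e \<circ> h) (Node f ts')" if "map (e \<circ> h) ts = map (e \<circ> h) ts'" for f ts ts'
  proof -
    from that have "map h ts = map h ts'" by (auto simp: list_eq_iff_nth_eq eq)
    with assms have "h (Node f ts) = h (Node f ts')" unfolding tree_congruence_def by blast
    then show ?thesis by simp
  qed
  moreover have "finite (range (e \<circ> h))"
    using \<open>finite (range h)\<close> by (metis finite_imageI image_comp)
  ultimately have "tree_congruence (e \<circ> h)" unfolding tree_congruence_def by blast
  with eq show thesis by (intro that[of "e \<circ> h"]) (simp_all only: comp_apply)
qed

lemma recognizableI:
  fixes h :: "'f tree \<Rightarrow> 's"
  assumes "tree_congruence h" "saturates h L"
  shows "recognizable L"
proof -
  obtain k :: "'f tree \<Rightarrow> nat" where "tree_congruence k" "\<And>s s'. k s = k s' \<longleftrightarrow> h s = h s'"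
    using tree_congruence_encode[OF assms(1)] by blast
  moreover from this(2) have "saturates k L" using assms(2) by (simp only: saturates_def)
  ultimately show ?thesis unfolding recognizable_def by blast
qed

lemma recognizable_UNIV: "recognizable UNIV"
  by (rule recognizableI[of "\<lambda>_. ()"]) (auto simp: tree_congruence_def saturates_def)

text \<open>The transition function of the automaton given by \<open>h\<close>, defined through
  representatives. For state lists outside the image of \<open>map h\<close> the representative is
  arbitrary, but the result is still a state (\<open>hop_range\<close>).\<close>

definition hop :: "('f tree \<Rightarrow> 's) \<Rightarrow> 'f \<Rightarrow> 's list \<Rightarrow> 's" where
  "hop h f qs = h (Node f (SOME ts. map h ts = qs))"

lemma hop_map: "tree_congruence h \<Longrightarrow> hop h f (map h ts) = h (Node f ts)"
proof -
  assume h: "tree_congruence h"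
  have "map h (SOME us. map h us = map h ts) = map h ts" by (rule someI) simp
  with h show ?thesis unfolding hop_def tree_congruence_def by blast
qed

lemma hop_range: "hop h f qs \<in> range h"
  by (simp add: hop_def)


section \<open>Domains of attributed tree transducers are recognizable\<close>

text \<open>\<open>sub A u J \<gamma> w\<close>: if the inherited attributes in \<open>J\<close> can derive output trees at the root of the
  subtree \<open>u\<close>, then so can \<open>\<gamma>\<close> at node \<open>w\<close> of \<open>u\<close>.\<close>

inductive sub :: "('q, 'f, 'g) att \<Rightarrow> 'f option tree \<Rightarrow> 'q set \<Rightarrow> 'q \<Rightarrow> nat list \<Rightarrow> bool"
  for A u J where
  fact: "b \<in> J \<Longrightarrow> sub A u J b []"
| rule: "node_label u v = Some \<sigma> \<Longrightarrow> ((\<gamma>, i), \<xi>) \<in> att_rules A \<sigma> \<Longrightarrow>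
    \<gamma> \<in> syn A \<and> i = 0 \<or> \<gamma> \<in> inh A \<and> i > 0 \<Longrightarrow>
    \<forall>y\<in>set2_ltree \<xi>. sub A u J (fst y) (child v (snd y)) \<Longrightarrow> w = child v i \<Longrightarrow> sub A u J \<gamma> w"

text \<open>The automaton state of the subtree \<open>u\<close>: the implications from inherited to
  synthesized attributes at its root, which capture its contribution to productivity in any context
  and range over a finite set.\<close>

definition summary :: "('q, 'f, 'g) att \<Rightarrow> 'f option tree \<Rightarrow> ('q \<times> 'q set) set" where
  "summary A u = {(a, J). a \<in> syn A \<and> J \<subseteq> inh A \<and> sub A u J a []}"

text \<open>The same closure restricted to a node and its children, where the subtrees at the children
  are known through their summaries only.\<close>

inductive loc :: "('q, 'f, 'g) att \<Rightarrow> 'f option \<Rightarrow> ('q \<times> 'q set) set list \<Rightarrow> 'q set \<Rightarrow> 'q \<Rightarrow> nat \<Rightarrow> bool"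
  for A \<sigma> zs J where
  fact: "b \<in> J \<Longrightarrow> loc A \<sigma> zs J b 0"
| rule: "((\<gamma>, i), \<xi>) \<in> att_rules A \<sigma> \<Longrightarrow> \<gamma> \<in> syn A \<and> i = 0 \<or> \<gamma> \<in> inh A \<and> i > 0 \<Longrightarrow>
    \<forall>y\<in>set2_ltree \<xi>. loc A \<sigma> zs J (fst y) (snd y) \<Longrightarrow> loc A \<sigma> zs J \<gamma> i"
| child: "j < length zs \<Longrightarrow> (a, K) \<in> zs ! j \<Longrightarrow> \<forall>b\<in>K. loc A \<sigma> zs J b (Suc j) \<Longrightarrow>
    loc A \<sigma> zs J a (Suc j)"

lemma child_Cons: "child (j # v) i = j # child v i"
  by (simp add: child_def)

lemma child_Nil_Suc: "child [] (Suc j) = [Suc j]"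
  by (simp add: child_def)

text \<open>A derivation inside a child replays inside the parent once its assumptions
  \<open>K\<close> are available at the root of the child.\<close>

lemma sub_shift:
  assumes "j < length us" "\<And>b. b \<in> K \<Longrightarrow> sub A (Node \<sigma> us) J b [Suc j]"
  shows "sub A (us ! j) K \<gamma> w \<Longrightarrow> sub A (Node \<sigma> us) J \<gamma> (Suc j # w)"
proof (induction rule: sub.induct)
  case (rule v \<sigma>' \<gamma> i \<xi> w)
  then show ?case using assms(1)
    by (auto simp: child_Cons intro!: sub.rule[of "Node \<sigma> us" "Suc j # v" \<sigma>' \<gamma> i \<xi>])
qed (use assms in auto)

lemma loc_imp_sub: "loc A \<sigma> (map (summary A) us) J \<gamma> j \<Longrightarrow> sub A (Node \<sigma> us) J \<gamma> (child [] j)"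
proof (induction rule: loc.induct)
  case (fact b)
  then show ?case by (auto simp: child_def intro: sub.fact)
next
  case (rule \<gamma> i \<xi>)
  then show ?case by (auto intro: sub.rule[of "Node \<sigma> us" "[]" \<sigma> \<gamma> i \<xi>])
next
  case (child j a K)
  then have "sub A (us ! j) K a []" by (simp add: summary_def)
  with child show ?case unfolding child_Nil_Suc by - (rule sub_shift[where K = K], auto)
qed

text \<open>The induction must follow facts deep inside a child although \<open>loc\<close> sees
  only its root. The invariant therefore keeps the derivation inside child \<open>j\<close> under
  the largest usable assumption set, all inherited attributes that \<open>loc\<close> yields at
  \<open>j\<close>; facts at the root of the child are kept in both forms.\<close>

lemma sub_imp_loc:
  assumes "J \<subseteq> inh A"
  defines "Z \<equiv> \<lambda>us. map (summary A) us"
  shows "sub A (Node \<sigma> us) J \<gamma> w \<Longrightarrow>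
    (w = [] \<longrightarrow> loc A \<sigma> (Z us) J \<gamma> 0) \<and>
    (\<forall>j v. w = j # v \<longrightarrow> (v = [] \<longrightarrow> loc A \<sigma> (Z us) J \<gamma> j) \<and>
      (1 \<le> j \<and> j \<le> length us \<longrightarrow> sub A (us ! (j - 1)) {b \<in> inh A. loc A \<sigma> (Z us) J b j} \<gamma> v))"
proof (induction rule: sub.induct)
  case (fact b)
  then show ?case by (auto intro: loc.fact)
next
  case (rule v \<tau> \<gamma> i \<xi> w)
  show ?case
  proof (cases v)
    case Nil
    have "loc A \<sigma> (Z us) J \<gamma> i"
    proof (rule loc.rule)
      show "((\<gamma>, i), \<xi>) \<in> att_rules A \<sigma>" using rule Nil by simp
      show "\<gamma> \<in> syn A \<and> i = 0 \<or> \<gamma> \<in> inh A \<and> i > 0" by fact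
      show "\<forall>y\<in>set2_ltree \<xi>. loc A \<sigma> (Z us) J (fst y) (snd y)"
      proof
        fix y assume "y \<in> set2_ltree \<xi>"
        with rule(5) Nil show "loc A \<sigma> (Z us) J (fst y) (snd y)"
          by (cases "snd y = 0") (auto simp: child_def)
      qed
    qed
    \<comment> \<open>If \<open>i > 0\<close>, the inherited attribute has just entered the
      assumption set of child \<open>i\<close>, so \<open>sub.fact\<close> applies there.\<close>
    with rule(3,4) Nil show ?thesis by (auto simp: child_def intro: sub.fact)
  next
    case (Cons j v')
    with rule(1) have j: "1 \<le> j" "j \<le> length us" "node_label (us ! (j - 1)) v' = Some \<tau>"
      by (auto split: if_splits)
    have sub: "sub A (us ! (j - 1)) {b \<in> inh A. loc A \<sigma> (Z us) J b j} \<gamma> (child v' i)"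
      by (rule sub.rule[OF j(3) rule(2,3)]) (use rule(5) j Cons in \<open>auto simp: child_Cons\<close>)
    \<comment> \<open>Reaching the root of the child forces \<open>i = 0\<close>, so
      \<open>\<gamma>\<close> is synthesized and the derivation is an entry of the child's
      summary.\<close>
    moreover have "loc A \<sigma> (Z us) J \<gamma> j" if "child v' i = []"
    proof -
      from that rule(3) have "\<gamma> \<in> syn A" by (auto simp: child_def split: if_splits)
      with sub that have "(\<gamma>, {b \<in> inh A. loc A \<sigma> (Z us) J b j}) \<in> summary A (us ! (j - 1))"
        by (auto simp: summary_def)
      with j show ?thesis using loc.child[of "j - 1" "Z us" \<gamma> _ A \<sigma> J] by (auto simp: Z_def)
    qed
    ultimately show ?thesis using rule(4) Cons by (auto simp: child_Cons)
  qed
qed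

lemma sub_Node_iff:
  "J \<subseteq> inh A \<Longrightarrow> sub A (Node \<sigma> us) J \<gamma> (child [] j) \<longleftrightarrow> loc A \<sigma> (map (summary A) us) J \<gamma> j"
  using sub_imp_loc[of J A \<sigma> us \<gamma> "child [] j"] loc_imp_sub[of A \<sigma> us J \<gamma> j]
  by (auto simp: child_def split: if_splits)

lemma sub_iff_gder: "sub A s {} \<gamma> w \<longleftrightarrow> (\<exists>t. gder (ground A s) (\<gamma>, w) t)"
proof
  show "\<exists>t. gder (ground A s) (\<gamma>, w) t" if "sub A s {} \<gamma> w"
    using that
  proof (induction rule: sub.induct)
    case (rule v \<sigma> \<gamma> i \<xi> w)
    let ?\<zeta> = "lmap (\<lambda>(\<gamma>', j). (\<gamma>', child v j)) \<xi>"
    have "\<exists>t. deval (gder (ground A s)) ?\<zeta> t" using rule(5) by (intro deval_ex) fastforce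
    moreover have "((\<gamma>, w), ?\<zeta>) \<in> ground A s" using rule by (intro groundI) auto
    ultimately show ?case by (auto intro: gder.intros)
  qed auto
next
  have "gder (ground A s) x t \<Longrightarrow> sub A s {} (fst x) (snd x)" for x t
  proof (induction rule: gder.induct)
    case (1 x \<zeta> t)
    from 1(1) show ?case
    proof (cases rule: groundE)
      case r: (1 v \<sigma> \<gamma> i \<xi>)
      have "\<forall>y\<in>set2_ltree \<zeta>. sub A s {} (fst y) (snd y)" using deval_leaves[OF 1(2)] by auto
      then show ?thesis unfolding r(4) fst_conv snd_conv
        by (intro sub.rule[OF r(1-3)]) (auto simp: r(5))
    qed
  qed
  then show "\<exists>t. gder (ground A s) (\<gamma>, w) t \<Longrightarrow> sub A s {} \<gamma> w" by fastforce
qed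

lemma recognizable_productive:
  assumes "att A"
  shows "recognizable {s. \<exists>t. gder (ground A (mark s)) (a, [1]) t}"
proof (rule recognizableI)
  define h where "h s = summary A (map_tree Some s)" for s
  have "range h \<subseteq> Pow (syn A \<times> Pow (inh A))" by (auto simp: h_def summary_def)
  moreover have "finite (Pow (syn A \<times> Pow (inh A)))" using assms by (simp add: att_def)
  ultimately have "finite (range h)" by (rule finite_subset)
  moreover have "h (Node f ts) = h (Node f ts')" if "map h ts = map h ts'" for f ts ts'
  proof -
    have "map (summary A) (map (map_tree Some) ts) = map (summary A) (map (map_tree Some) ts')"
      using that unfolding h_def by (auto simp: list_eq_iff_nth_eq)
    then show ?thesis
      using sub_Node_iff[of _ A _ _ _ 0] by (auto simp: h_def summary_def child_def)
  qed
  ultimately show "tree_congruence h" unfolding tree_congruence_def by blast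
  \<comment> \<open>\<open>mark s\<close> is the marker over the single subtree
    \<open>map_tree Some s\<close>, so one further local closure over \<open>h s\<close> decides
    productivity at node \<open>[1]\<close>.\<close>
  have "(\<exists>t. gder (ground A (mark s)) (a, [1]) t) \<longleftrightarrow> loc A None [h s] {} a 1" for s
    using sub_Node_iff[of "{}" A None "[map_tree Some s]" a 1]
    by (simp add: sub_iff_gder[symmetric] mark_def child_def h_def)
  then show "saturates h {s. \<exists>t. gder (ground A (mark s)) (a, [1]) t}" by (simp add: saturates_def)
qed


section \<open>Restricting the range to a recognizable language\<close>

text \<open>The automaton state of a right-hand side, given states for its leaves; it is computed on
  the rule, before any output tree is known.\<close>

primrec hval :: "('f tree \<Rightarrow> 's) \<Rightarrow> ('x \<Rightarrow> 's) \<Rightarrow> ('f, 'x) ltree \<Rightarrow> 's" where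
  "hval h g (Leaf x) = g x"
| "hval h g (Op f xs) = hop h f (map (hval h g) xs)"

lemma hval_deval:
  assumes "tree_congruence h"
  shows "deval (\<lambda>x t. E x t \<and> h t = g x) \<xi> t \<Longrightarrow> hval h g \<xi> = h t"
proof (induction \<xi> arbitrary: t)
  case (Op f xs)
  then obtain ts where ts: "t = Node f ts" "list_all2 (deval (\<lambda>x t. E x t \<and> h t = g x)) xs ts"
    by (auto simp: deval_Op_iff)
  then have "map (hval h g) xs = map h ts"
    using Op.IH by (auto simp: list_all2_conv_all_nth intro!: nth_equalityI)
  with ts show ?case by (simp add: hop_map[OF assms])
qed auto

lemma hval_range:
  fixes \<xi> :: "('f, 'x) ltree"
  shows "g ` set2_ltree \<xi> \<subseteq> range h \<Longrightarrow> hval h g \<xi> \<in> range h"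
  by (cases \<xi>) (auto simp: hop_range)

text \<open>A tree has finitely many leaf occurrences, and each has finitely many preimages in
  \<open>X\<close>; this bounds the number of annotated copies of a rule.\<close>

lemma finite_lmap_vimage:
  fixes \<zeta> :: "('f, 'y) ltree"
  assumes "finite X"
  shows "finite {\<xi>. lmap g \<xi> = \<zeta> \<and> set2_ltree \<xi> \<subseteq> X}"
proof (induction \<zeta>)
  case (Leaf y)
  have "{\<xi>. lmap g \<xi> = Leaf y \<and> set2_ltree \<xi> \<subseteq> X} \<subseteq> Leaf ` X"
  proof
    fix \<xi> assume "\<xi> \<in> {\<xi>. lmap g \<xi> = Leaf y \<and> set2_ltree \<xi> \<subseteq> X}"
    then show "\<xi> \<in> Leaf ` X" by (cases \<xi>) auto
  qed
  then show ?case using assms finite_subset by blast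
next
  case (Op f zs)
  let ?S = "\<Union>z\<in>set zs. {\<xi>. lmap g \<xi> = z \<and> set2_ltree \<xi> \<subseteq> X}"
  have "{\<xi>. lmap g \<xi> = Op f zs \<and> set2_ltree \<xi> \<subseteq> X} \<subseteq>
    Op f ` {xs. set xs \<subseteq> ?S \<and> length xs = length zs}"
  proof
    fix \<xi> assume "\<xi> \<in> {\<xi>. lmap g \<xi> = Op f zs \<and> set2_ltree \<xi> \<subseteq> X}"
    then obtain xs where "\<xi> = Op f xs" "zs = map (lmap g) xs" "\<forall>x\<in>set xs. set2_ltree x \<subseteq> X"
      by (cases \<xi>) auto
    then show "\<xi> \<in> Op f ` {xs. set xs \<subseteq> ?S \<and> length xs = length zs}" by auto
  qed
  moreover have "finite {xs. set xs \<subseteq> ?S \<and> length xs = length zs}"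
    using Op by (intro finite_lists_length_eq) auto
  ultimately show ?case by (meson finite_imageI finite_subset)
qed

text \<open>The attribute \<open>(\<gamma>, q)\<close> derives the output trees of \<open>\<gamma>\<close> that have state \<open>q\<close>. Different
  occurrences of an attribute in a right-hand side may be given different states.\<close>

definition restrict_range :: "('q, 'f, 'g) att \<Rightarrow> ('g tree \<Rightarrow> 's) \<Rightarrow> ('q \<times> 's, 'f, 'g) att" where
  "restrict_range A h =
     \<lparr>syn = syn A \<times> range h, inh = inh A \<times> range h, att_in = att_in A, att_out = att_out A,
      att_init = (att_init A, h undefined),
      att_rules = \<lambda>\<sigma>. {(((\<gamma>, hval h (snd \<circ> fst) \<xi>), i), \<xi>) | \<gamma> i \<xi>.
        ((\<gamma>, i), lmap (apfst fst) \<xi>) \<in> att_rules A \<sigma> \<and> (snd \<circ> fst) ` set2_ltree \<xi> \<subseteq> range h}\<rparr>"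

lemma restrict_range_sel [simp]:
  "syn (restrict_range A h) = syn A \<times> range h"
  "inh (restrict_range A h) = inh A \<times> range h"
  "att_in (restrict_range A h) = att_in A"
  "att_out (restrict_range A h) = att_out A"
  by (simp_all add: restrict_range_def)

lemma restrict_range_rules_iff:
  "(((\<gamma>, q), i), \<xi>) \<in> att_rules (restrict_range A h) \<sigma> \<longleftrightarrow>
    q = hval h (snd \<circ> fst) \<xi> \<and> ((\<gamma>, i), lmap (apfst fst) \<xi>) \<in> att_rules A \<sigma> \<and>
    (snd \<circ> fst) ` set2_ltree \<xi> \<subseteq> range h"
  by (auto simp: restrict_range_def)

lemma finite_restrict_range_rules:
  assumes "tree_congruence h" "finite (att_rules A \<sigma>)"
  shows "finite (att_rules (restrict_range A h) \<sigma>)"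
proof -
  define X where "X \<zeta> = (\<lambda>((\<gamma>, j), q). ((\<gamma>, q), j)) ` (set2_ltree \<zeta> \<times> range h)"
    for \<zeta> :: "('a, 'c \<times> nat) ltree"
  have "att_rules (restrict_range A h) \<sigma> \<subseteq>
    (\<lambda>((\<gamma>, i), \<xi>). (((\<gamma>, hval h (snd \<circ> fst) \<xi>), i), \<xi>)) `
      (\<Union>(l, \<zeta>)\<in>att_rules A \<sigma>. {l} \<times> {\<xi>. lmap (apfst fst) \<xi> = \<zeta> \<and> set2_ltree \<xi> \<subseteq> X \<zeta>})"
  proof
    fix r assume "r \<in> att_rules (restrict_range A h) \<sigma>"
    then obtain \<gamma> i \<xi> where r: "r = (((\<gamma>, hval h (snd \<circ> fst) \<xi>), i), \<xi>)"
      "((\<gamma>, i), lmap (apfst fst) \<xi>) \<in> att_rules A \<sigma>" "(snd \<circ> fst) ` set2_ltree \<xi> \<subseteq> range h"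
      by (auto simp: restrict_range_def)
    have "set2_ltree \<xi> \<subseteq> X (lmap (apfst fst) \<xi>)"
      using r(3) by (force simp: X_def image_iff)
    with r show "r \<in> (\<lambda>((\<gamma>, i), \<xi>). (((\<gamma>, hval h (snd \<circ> fst) \<xi>), i), \<xi>)) `
      (\<Union>(l, \<zeta>)\<in>att_rules A \<sigma>. {l} \<times> {\<xi>. lmap (apfst fst) \<xi> = \<zeta> \<and> set2_ltree \<xi> \<subseteq> X \<zeta>})"
      by (intro image_eqI[where x="((\<gamma>, i), \<xi>)"]) auto
  qed
  moreover have "finite (X \<zeta>)" for \<zeta>
    using assms(1) by (auto simp: X_def finite_leaves tree_congruence_def)
  then have "finite (\<Union>(l, \<zeta>)\<in>att_rules A \<sigma>. {l} \<times> {\<xi>. lmap (apfst fst) \<xi> = \<zeta> \<and> set2_ltree \<xi> \<subseteq> X \<zeta>})"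
    using assms(2) by (auto intro!: finite_lmap_vimage)
  ultimately show ?thesis by (meson finite_imageI finite_subset)
qed

lemma lmap_ltreesD: "lmap g \<xi> \<in> ltrees \<Delta> \<Lambda> \<Longrightarrow> \<xi> \<in> ltrees \<Delta> (g -` \<Lambda> \<inter> set2_ltree \<xi>)"
  using ltrees_leaves[of "lmap g \<xi>" \<Delta> \<Lambda>] 
  by - (rule ltrees_unmap[of g], auto simp: image_subset_iff)

lemma attI:
  assumes "finite (syn A)" "finite (inh A)" "syn A \<inter> inh A = {}" "ranked_alphabet (att_in A)"
    "ranked_alphabet (att_out A)" "att_init A \<in> syn A"
    "\<And>\<sigma> k. marked (att_in A) \<sigma> = Some k \<Longrightarrow> finite (att_rules A \<sigma>)"
    "\<And>\<sigma> k \<gamma> i \<xi>. att_in A \<sigma> = Some k \<Longrightarrow> ((\<gamma>, i), \<xi>) \<in> att_rules A (Some \<sigma>) \<Longrightarrow>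
      (\<gamma> \<in> syn A \<and> i = 0 \<or> \<gamma> \<in> inh A \<and> i \<in> {1..k}) \<and>
      \<xi> \<in> ltrees (att_out A) (syn A \<times> {1..k} \<union> inh A \<times> {0})"
    "\<And>\<gamma> i \<xi>. ((\<gamma>, i), \<xi>) \<in> att_rules A None \<Longrightarrow>
      \<gamma> \<in> inh A \<and> i = 1 \<and> \<xi> \<in> ltrees (att_out A) (syn A \<times> {1})"
  shows "att A"
proof -
  have "finite (att_rules A None)" using assms(7)[of None] by (simp add: marked_def)
  moreover have "finite (att_rules A (Some \<sigma>))" if "att_in A \<sigma> = Some k" for \<sigma> k
    using assms(7)[of "Some \<sigma>"] that by (simp add: marked_def)
  ultimately show ?thesis
    unfolding att_def using assms(1-6) by (auto simp del: atLeastAtMost_iff dest!: assms(8,9))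
qed

lemma att_root_ruleD:
  "att A \<Longrightarrow> ((\<gamma>, i), \<xi>) \<in> att_rules A None \<Longrightarrow>
    \<gamma> \<in> inh A \<and> i = 1 \<and> \<xi> \<in> ltrees (att_out A) (syn A \<times> {1})"
  unfolding att_def by (auto split: prod.splits)

lemma att_finite_rules: "att A \<Longrightarrow> marked (att_in A) \<sigma> = Some k \<Longrightarrow> finite (att_rules A \<sigma>)"
  unfolding att_def by (cases \<sigma>) (auto simp: marked_def)

text \<open>In the initial attribute, \<open>h undefined\<close> supplies some element of the range.
  A single start attribute cannot express membership in a language that is a union of classes; the
  start attributes are handed to locale \<open>choice\<close> as \<open>Init\<close>.\<close>

lemma att_restrict_range:
  assumes "att A" "tree_congruence h"
  shows "att (restrict_range A h)"
proof (rule attI)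
  show "finite (syn (restrict_range A h))" "finite (inh (restrict_range A h))"
    "syn (restrict_range A h) \<inter> inh (restrict_range A h) = {}"
    "ranked_alphabet (att_in (restrict_range A h))"
    "ranked_alphabet (att_out (restrict_range A h))"
    "att_init (restrict_range A h) \<in> syn (restrict_range A h)"
    using assms by (auto simp: att_def tree_congruence_def restrict_range_def)
  show "finite (att_rules (restrict_range A h) \<sigma>)"
    if "marked (att_in (restrict_range A h)) \<sigma> = Some k" for \<sigma> k
    using finite_restrict_range_rules[OF assms(2) att_finite_rules[OF assms(1)]] that by simp
next
  fix \<sigma> k \<gamma> i \<xi>
  assume *: "att_in (restrict_range A h) \<sigma> = Some k"
    "((\<gamma>, i), \<xi>) \<in> att_rules (restrict_range A h) (Some \<sigma>)"
  obtain \<gamma>' q where \<gamma>: "\<gamma> = (\<gamma>', q)" by (cases \<gamma>)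
  with * have r: "q = hval h (snd \<circ> fst) \<xi>" "((\<gamma>', i), lmap (apfst fst) \<xi>) \<in> att_rules A (Some \<sigma>)"
    "(snd \<circ> fst) ` set2_ltree \<xi> \<subseteq> range h" by (auto simp: restrict_range_rules_iff)
  have "marked (att_in A) (Some \<sigma>) = Some k" using * by (simp add: marked_def)
  note D = att_ruleD[OF assms(1) this r(2)]
  have "\<xi> \<in> ltrees (att_out A) ((syn A \<times> range h) \<times> {1..k} \<union> (inh A \<times> range h) \<times> {0})"
    by (rule ltrees_mono[OF lmap_ltreesD[OF D(2)]]) (use r(3) in \<open>force\<close>)
  with D(1) hval_range[OF r(3)] r(1) \<gamma>
  show "(\<gamma> \<in> syn (restrict_range A h) \<and> i = 0 \<or> \<gamma> \<in> inh (restrict_range A h) \<and> i \<in> {1..k}) \<and>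
    \<xi> \<in> ltrees (att_out (restrict_range A h))
      (syn (restrict_range A h) \<times> {1..k} \<union> inh (restrict_range A h) \<times> {0})"
    by auto
next
  fix \<gamma> i \<xi>
  assume *: "((\<gamma>, i), \<xi>) \<in> att_rules (restrict_range A h) None"
  obtain \<gamma>' q where \<gamma>: "\<gamma> = (\<gamma>', q)" by (cases \<gamma>)
  with * have r: "q = hval h (snd \<circ> fst) \<xi>" "((\<gamma>', i), lmap (apfst fst) \<xi>) \<in> att_rules A None"
    "(snd \<circ> fst) ` set2_ltree \<xi> \<subseteq> range h" by (auto simp: restrict_range_rules_iff)
  note D = att_root_ruleD[OF assms(1) r(2)]
  have "\<xi> \<in> ltrees (att_out A) ((syn A \<times> range h) \<times> {1})"
    by (rule ltrees_mono[OF lmap_ltreesD]) (use D r(3) in \<open>force+\<close>)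
  with D hval_range[OF r(3)] r(1) \<gamma>
  show "\<gamma> \<in> inh (restrict_range A h) \<and> i = 1 \<and>
    \<xi> \<in> ltrees (att_out (restrict_range A h)) (syn (restrict_range A h) \<times> {1})"
    by auto
qed

text \<open>Each leaf occurrence is tagged with the class of the tree that replaced it in this
  particular evaluation; the tags may differ between occurrences of the same leaf.\<close>

lemma annotate:
  "deval E \<xi> t \<Longrightarrow> \<exists>\<xi>'. lmap (apfst fst) \<xi>' = \<xi> \<and> (snd \<circ> fst) ` set2_ltree \<xi>' \<subseteq> range h \<and>
     deval (\<lambda>x u. E (apfst fst x) u \<and> h u = (snd \<circ> fst) x) \<xi>' t"
proof (induction \<xi> arbitrary: t)
  case (Leaf x)
  then show ?case by (intro exI[of _ "Leaf ((fst x, h t), snd x)"]) auto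
next
  case (Op f xs)
  let ?P = "\<lambda>\<xi>' \<xi> t. lmap (apfst fst) \<xi>' = \<xi> \<and> (snd \<circ> fst) ` set2_ltree \<xi>' \<subseteq> range h \<and>
     deval (\<lambda>x u. E (apfst fst x) u \<and> h u = (snd \<circ> fst) x) \<xi>' t"
  from Op.prems obtain ts where ts: "t = Node f ts" "list_all2 (deval E) xs ts"
    by (auto simp: deval_Op_iff)
  then have "\<forall>i<length xs. \<exists>\<xi>'. ?P \<xi>' (xs ! i) (ts ! i)"
    using Op.IH by (simp add: list_all2_conv_all_nth)
  from iffD1[OF choice_iff' this] obtain X where X: "\<forall>i<length xs. ?P (X i) (xs ! i) (ts ! i)" ..
  define ys where "ys = map X [0..<length xs]"
  have 1: "map (lmap (apfst fst)) ys = xs"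
    using X by (intro nth_equalityI) (simp_all add: ys_def)
  have 2: "\<forall>y\<in>set ys. (snd \<circ> fst) ` set2_ltree y \<subseteq> range h"
    using X by (simp add: ys_def)
  have 3: "list_all2 (deval (\<lambda>x u. E (apfst fst x) u \<and> h u = (snd \<circ> fst) x)) ys ts"
    using X ts(2) by (simp add: ys_def list_all2_conv_all_nth)
  have "?P (Op f ys) (Op f xs) t"
    using 1 2 3 ts(1) by (simp add: deval_Op_iff image_UN UN_subset_iff)
  then show ?case by blast
qed

lemma gder_restrict_rangeD:
  assumes "tree_congruence h"
  shows "gder (ground (restrict_range A h) s) x t \<Longrightarrow>
    gder (ground A s) (apfst fst x) t \<and> h t = (snd \<circ> fst) x"
proof (induction rule: gder.induct)
  case (1 x \<zeta> t)
  from 1(1) show ?case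
  proof (cases rule: groundE)
    case r: (1 v \<sigma> \<gamma>q i \<xi>)
    obtain \<gamma> q where \<gamma>q: "\<gamma>q = (\<gamma>, q)" by (cases \<gamma>q)
    have q: "q = hval h (snd \<circ> fst) \<xi>" "((\<gamma>, i), lmap (apfst fst) \<xi>) \<in> att_rules A \<sigma>"
      using r(2) \<gamma>q by (auto simp: restrict_range_rules_iff)
    have d: "deval (\<lambda>x u. gder (ground A s) (fst (fst x), child v (snd x)) u \<and> h u = (snd \<circ> fst) x) \<xi> t"
      using 1(2) r(5) by (auto simp: deval_map apfst_def map_prod_def split_beta elim: deval_cong_leaves)
    have "h t = q" unfolding q(1) by (rule hval_deval[OF assms d, symmetric])
    moreover have "gder (ground A s) (\<gamma>, child v i) t"
    proof (rule gder.intros)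
      show "((\<gamma>, child v i), lmap (\<lambda>(\<gamma>', j). (\<gamma>', child v j)) (lmap (apfst fst) \<xi>)) \<in> ground A s"
        using r q \<gamma>q by (intro groundI) auto
      show "deval (gder (ground A s)) (lmap (\<lambda>(\<gamma>', j). (\<gamma>', child v j)) (lmap (apfst fst) \<xi>)) t"
        using d by (auto simp: deval_map split_beta elim: deval_cong_leaves)
    qed
    ultimately show ?thesis using r(4) \<gamma>q by simp
  qed
qed

lemma gder_restrict_rangeI:
  assumes "tree_congruence h"
  shows "gder (ground A s) x t \<Longrightarrow> gder (ground (restrict_range A h) s) ((fst x, h t), snd x) t"
proof (induction rule: gder.induct)
  case (1 x \<zeta> t)
  let ?G = "ground (restrict_range A h) s"
  from 1(1) show ?case
  proof (cases rule: groundE)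
    case r: (1 v \<sigma> \<gamma> i \<xi>)
    have "deval (\<lambda>x u. gder ?G ((fst x, h u), child v (snd x)) u) \<xi> t"
      using 1(2) r(5) by (auto simp: deval_map split_beta elim: deval_cong_leaves)
    from annotate[OF this, of h] obtain \<xi>' where \<xi>': "lmap (apfst fst) \<xi>' = \<xi>"
      "(snd \<circ> fst) ` set2_ltree \<xi>' \<subseteq> range h"
      "deval (\<lambda>x u. gder ?G ((fst (fst x), h u), child v (snd x)) u \<and> h u = (snd \<circ> fst) x) \<xi>' t"
      by auto
    have ht: "hval h (snd \<circ> fst) \<xi>' = h t" using hval_deval[OF assms \<xi>'(3)] .
    show ?thesis
    proof (rule gder.intros)
      show "(((fst x, h t), snd x), lmap (\<lambda>(\<gamma>', j). (\<gamma>', child v j)) \<xi>') \<in> ?G"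
        using r \<xi>' ht by (intro groundI) (auto simp: restrict_range_rules_iff)
      show "deval (gder ?G) (lmap (\<lambda>(\<gamma>', j). (\<gamma>', child v j)) \<xi>') t"
        using \<xi>'(3) by (auto simp: deval_map split_beta elim: deval_cong_leaves)
    qed
  qed
qed

lemma gder_restrict_range_iff:
  assumes "tree_congruence h"
  shows "gder (ground (restrict_range A h) s) ((\<gamma>, q), w) t \<longleftrightarrow> gder (ground A s) (\<gamma>, w) t \<and> h t = q"
  using gder_restrict_rangeD[OF assms, of A s "((\<gamma>, q), w)"] gder_restrict_rangeI[OF assms, of A s "(\<gamma>, w)"]
  by auto


section \<open>Renaming attributes\<close>

text \<open>Serves to bring structured attributes into \<open>nat\<close>, as \<open>attU\<close>
  demands. Only rules for proper attributes are kept, so that injectivity of \<open>e\<close> on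
  these recovers the original left-hand side.\<close>

definition rename_att :: "('q \<Rightarrow> 'r) \<Rightarrow> ('q, 'f, 'g) att \<Rightarrow> ('r, 'f, 'g) att" where
  "rename_att e A =
     \<lparr>syn = e ` syn A, inh = e ` inh A, att_in = att_in A, att_out = att_out A,
      att_init = e (att_init A),
      att_rules = \<lambda>\<sigma>. {((e \<gamma>, i), lmap (apfst e) \<xi>) | \<gamma> i \<xi>.
        ((\<gamma>, i), \<xi>) \<in> att_rules A \<sigma> \<and> \<gamma> \<in> syn A \<union> inh A}\<rparr>"

lemma rename_att_sel [simp]:
  "syn (rename_att e A) = e ` syn A" "inh (rename_att e A) = e ` inh A"
  "att_in (rename_att e A) = att_in A" "att_out (rename_att e A) = att_out A"
  "att_init (rename_att e A) = e (att_init A)"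
  by (simp_all add: rename_att_def)

lemma rename_att_rulesE:
  assumes "((\<delta>, i), \<zeta>) \<in> att_rules (rename_att e A) \<sigma>"
  obtains \<gamma> \<xi> where "\<delta> = e \<gamma>" "\<zeta> = lmap (apfst e) \<xi>" "((\<gamma>, i), \<xi>) \<in> att_rules A \<sigma>"
    "\<gamma> \<in> syn A \<union> inh A"
  using assms by (auto simp: rename_att_def)

lemma att_rename_att:
  assumes "att A" "inj_on e (syn A \<union> inh A)"
  shows "att (rename_att e A)"
proof (rule attI)
  have "finite (syn A)" "finite (inh A)" "syn A \<inter> inh A = {}" "ranked_alphabet (att_in A)"
    "ranked_alphabet (att_out A)" "att_init A \<in> syn A"
    using assms(1) by (auto simp: att_def)
  then show "finite (syn (rename_att e A))" "finite (inh (rename_att e A))"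
    "syn (rename_att e A) \<inter> inh (rename_att e A) = {}" "ranked_alphabet (att_in (rename_att e A))"
    "ranked_alphabet (att_out (rename_att e A))" "att_init (rename_att e A) \<in> syn (rename_att e A)"
    using assms(2) by (auto dest: inj_onD)
next
  fix \<sigma> k assume "marked (att_in (rename_att e A)) \<sigma> = Some k"
  then have "finite ((\<lambda>((\<gamma>, i), \<xi>). ((e \<gamma>, i), lmap (apfst e) \<xi>)) ` att_rules A \<sigma>)"
    using att_finite_rules[OF assms(1)] by simp
  then show "finite (att_rules (rename_att e A) \<sigma>)"
    by (rule rev_finite_subset) (force simp: rename_att_def)
next
  fix \<sigma> k \<delta> i \<zeta>
  assume *: "att_in (rename_att e A) \<sigma> = Some k" "((\<delta>, i), \<zeta>) \<in> att_rules (rename_att e A) (Some \<sigma>)"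
  from *(2) show "(\<delta> \<in> syn (rename_att e A) \<and> i = 0 \<or> \<delta> \<in> inh (rename_att e A) \<and> i \<in> {1..k}) \<and>
    \<zeta> \<in> ltrees (att_out (rename_att e A))
      (syn (rename_att e A) \<times> {1..k} \<union> inh (rename_att e A) \<times> {0})"
  proof (cases rule: rename_att_rulesE)
    case (1 \<gamma> \<xi>)
    from *(1) have "marked (att_in A) (Some \<sigma>) = Some k" by (simp add: marked_def)
    note D = att_ruleD[OF assms(1) this 1(3)]
    have "\<zeta> \<in> ltrees (att_out A) (e ` syn A \<times> {1..k} \<union> e ` inh A \<times> {0})"
      unfolding 1(2) by (rule ltrees_map[OF D(2)]) auto
    with D(1) 1(1) show ?thesis by auto
  qed
next
  fix \<delta> i \<zeta>
  assume "((\<delta>, i), \<zeta>) \<in> att_rules (rename_att e A) None"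
  then show "\<delta> \<in> inh (rename_att e A) \<and> i = 1 \<and>
    \<zeta> \<in> ltrees (att_out (rename_att e A)) (syn (rename_att e A) \<times> {1})"
  proof (cases rule: rename_att_rulesE)
    case (1 \<gamma> \<xi>)
    note D = att_root_ruleD[OF assms(1) 1(3)]
    have "\<zeta> \<in> ltrees (att_out A) (e ` syn A \<times> {1})"
      unfolding 1(2) by (rule ltrees_map[OF D[THEN conjunct2, THEN conjunct2]]) auto
    with D 1(1) show ?thesis by auto
  qed
qed

lemma datt_rename_att:
  assumes "datt A" "inj_on e (syn A \<union> inh A)"
  shows "datt (rename_att e A)"
  unfolding datt_def
proof
  show "att (rename_att e A)" using assms by (auto simp: datt_def intro: att_rename_att)
  have det: "deterministic A" using assms by (simp add: datt_def)
  show "deterministic (rename_att e A)"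
    unfolding deterministic_def
  proof (intro ballI allI impI)
    fix \<sigma> l \<zeta> \<zeta>'
    assume \<sigma>: "\<sigma> \<in> insert None (Some ` dom (att_in (rename_att e A)))"
      and "(l, \<zeta>) \<in> att_rules (rename_att e A) \<sigma> \<and> (l, \<zeta>') \<in> att_rules (rename_att e A) \<sigma>"
    moreover obtain \<delta> i where "l = (\<delta>, i)" by (cases l)
    ultimately have *: "((\<delta>, i), \<zeta>) \<in> att_rules (rename_att e A) \<sigma>"
      "((\<delta>, i), \<zeta>') \<in> att_rules (rename_att e A) \<sigma>" by auto
    from *(1) obtain \<gamma> \<xi> where 1: "\<delta> = e \<gamma>" "\<zeta> = lmap (apfst e) \<xi>" "((\<gamma>, i), \<xi>) \<in> att_rules A \<sigma>"
      "\<gamma> \<in> syn A \<union> inh A" by (rule rename_att_rulesE)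
    from *(2) obtain \<gamma>' \<xi>' where 2: "\<delta> = e \<gamma>'" "\<zeta>' = lmap (apfst e) \<xi>'"
      "((\<gamma>', i), \<xi>') \<in> att_rules A \<sigma>" "\<gamma>' \<in> syn A \<union> inh A" by (rule rename_att_rulesE)
    have "\<gamma> = \<gamma>'" using assms(2) 1 2 by (auto dest: inj_onD)
    with det 1(3) 2(3) \<sigma> have "\<xi> = \<xi>'" unfolding deterministic_def rename_att_sel by blast
    with 1 2 show "\<zeta> = \<zeta>'" by simp
  qed
qed

lemma att_trans_rename_att:
  assumes "att A" "inj_on e (syn A \<union> inh A)"
  shows "att_trans (rename_att e A) = att_trans A"
proof -
  have "gder (ground (rename_att e A) (mark s)) (e (att_init A), [1]) t \<longleftrightarrow>
    gder (ground A (mark s)) (att_init A, [1]) t" if s: "s \<in> trees (att_in A)" for s t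
  proof
    define d where "d = inv_into (syn A \<union> inh A) e"
    have d: "d (e \<gamma>) = \<gamma>" if "\<gamma> \<in> syn A \<union> inh A" for \<gamma>
      using that assms(2) by (simp add: d_def inv_into_f_f)
    have "(apfst d x, lmap (apfst d) \<zeta>) \<in> ground A (mark s)"
      if "(x, \<zeta>) \<in> ground (rename_att e A) (mark s)" for x \<zeta>
      using that
    proof (cases rule: groundE)
      case (1 v \<sigma> \<delta> i \<theta>)
      from 1(2) show ?thesis
      proof (cases rule: rename_att_rulesE)
        case r: (1 \<gamma> \<xi>)
        from trees_node_label[OF mark_trees[OF s] 1(1)] obtain k where
          k: "marked (att_in A) \<sigma> = Some k" by blast
        have leaves: "fst y \<in> syn A \<union> inh A" if "y \<in> set2_ltree \<xi>" for y
          using ltrees_leaves[OF att_ruleD(2)[OF assms(1) k r(3)]] that by auto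
        have "lmap (apfst d) \<zeta> = lmap (\<lambda>(\<gamma>', j). (\<gamma>', child v j)) \<xi>"
          unfolding 1 r lmap_lmap using leaves by (intro lmap_cong) (auto simp: d split_beta)
        then show ?thesis
          using 1(1) r(3) att_ruleD(1)[OF assms(1) k r(3)] 1(4) r(1,4)
          by (intro groundI) (auto simp: d)
      qed
    qed
    from gder_map[of _ "apfst d", OF this]
    show "gder (ground (rename_att e A) (mark s)) (e (att_init A), [1]) t \<Longrightarrow>
      gder (ground A (mark s)) (att_init A, [1]) t"
      using assms(1) d by (fastforce simp: att_def)
  next
    have "(apfst e x, lmap (apfst e) \<zeta>) \<in> ground (rename_att e A) (mark s)"
      if "(x, \<zeta>) \<in> ground A (mark s)" for x \<zeta>
      using that
    proof (cases rule: groundE)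
      case (1 v \<sigma> \<gamma> i \<xi>)
      have "((e \<gamma>, i), lmap (apfst e) \<xi>) \<in> att_rules (rename_att e A) \<sigma>"
        using 1 by (auto simp: rename_att_def)
      moreover have "lmap (apfst e) \<zeta> = lmap (\<lambda>(\<gamma>', j). (\<gamma>', child v j)) (lmap (apfst e) \<xi>)"
        unfolding 1 lmap_lmap by (intro lmap_cong) auto
      ultimately show ?thesis using 1 by (intro groundI) auto
    qed
    from gder_map[of _ "apfst e", OF this]
    show "gder (ground A (mark s)) (att_init A, [1]) t \<Longrightarrow>
      gder (ground (rename_att e A) (mark s)) (e (att_init A), [1]) t"
      by fastforce
  qed
  then show ?thesis
    using att_trans_iff[OF assms(1)] att_trans_iff[OF att_rename_att[OF assms]] by auto
qed


section \<open>Deterministic transducers on input trees labeled with chosen rules\<close>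

type_synonym ('q, 'g) rules = "(('q \<times> nat) \<times> ('g, 'q \<times> nat) ltree) set"

text \<open>A label \<open>(\<sigma>, c, a, r)\<close> consists of an input symbol \<open>\<sigma>\<close>, the rules \<open>c\<close> chosen for a node labeled
  \<open>\<sigma>\<close>, an initial attribute \<open>a\<close> and the rules \<open>r\<close> chosen for the root marker. The components \<open>a\<close> and
  \<open>r\<close> are used at the root only, because the root marker cannot carry them.\<close>

definition choice_labels ::
  "('q, 'f, 'g) att \<Rightarrow> 'q set \<Rightarrow> ('f \<times> ('q, 'g) rules \<times> 'q \<times> ('q, 'g) rules) set" where
  "choice_labels A Init = {(\<sigma>, c, a, r). \<sigma> \<in> dom (att_in A) \<and> c \<subseteq> att_rules A (Some \<sigma>) \<and>
     single_valued c \<and> a \<in> Init \<and> r \<subseteq> att_rules A None \<and> single_valued r}"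

lemma finite_choice_labels:
  assumes "att A" "Init \<subseteq> syn A"
  shows "finite (choice_labels A Init)"
proof -
  have "choice_labels A Init \<subseteq> dom (att_in A) \<times>
    Pow (\<Union>\<sigma>\<in>dom (att_in A). att_rules A (Some \<sigma>)) \<times> syn A \<times> Pow (att_rules A None)"
    using assms(2) by (auto simp: choice_labels_def)
  moreover have "finite (dom (att_in A))" "finite (syn A)"
    using assms(1) by (auto simp: att_def ranked_alphabet_def)
  moreover have "finite (att_rules A None)"
    using att_finite_rules[OF assms(1), of None 1] by (simp add: marked_def)
  moreover have "finite (att_rules A (Some \<sigma>))" if "\<sigma> \<in> dom (att_in A)" for \<sigma>
    using att_finite_rules[OF assms(1), of "Some \<sigma>"] that by (auto simp: marked_def)
  ultimately show ?thesis by (auto intro: finite_subset)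
qed

text \<open>The composite labels do not belong to the symbol type that \<open>attU\<close> requires,
  so \<open>X\<close> is a set of code symbols and \<open>dec\<close> their decoding. A derivation
  may start from any attribute in \<open>Init\<close>; which one is used is part of the
  labeling.\<close>

locale choice =
  fixes A :: "('q, 'f, 'g) att" and Init :: "'q set" and X :: "'c set"
    and dec :: "'c \<Rightarrow> 'f \<times> ('q, 'g) rules \<times> 'q \<times> ('q, 'g) rules"
  assumes att: "att A" and Init: "Init \<subseteq> syn A" and dec: "bij_betw dec X (choice_labels A Init)"
begin

definition base :: "'c \<Rightarrow> 'f" where "base x = fst (dec x)"
definition chosen :: "'c \<Rightarrow> ('q, 'g) rules" where "chosen x = fst (snd (dec x))"
definition initial :: "'c \<Rightarrow> 'q" where "initial x = fst (snd (snd (dec x)))"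
definition root_chosen :: "'c \<Rightarrow> ('q, 'g) rules" where "root_chosen x = snd (snd (snd (dec x)))"

definition \<Gamma> :: "'c alphabet" where
  "\<Gamma> x = (if x \<in> X then att_in A (base x) else None)"

definition root_choices :: "('q, 'g) rules set" where
  "root_choices = {r. r \<subseteq> att_rules A None \<and> single_valued r}"

definition lift :: "('q, 'g) rules \<Rightarrow> ('g, 'q \<times> nat) ltree \<Rightarrow> ('g, ('q \<times> ('q, 'g) rules) option \<times> nat) ltree"
  where "lift r = lmap (\<lambda>(\<gamma>, j). (Some (\<gamma>, r), j))"

text \<open>The attributes carry the choice for the root marker; the new initial attribute \<open>None\<close> reads it
  from the label of the root.\<close>

definition D :: "(('q \<times> ('q, 'g) rules) option, 'c, 'g) att" where
  "D = \<lparr>syn = insert None (Some ` (syn A \<times> root_choices)), inh = Some ` (inh A \<times> root_choices),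
     att_in = \<Gamma>, att_out = att_out A, att_init = None,
     att_rules = \<lambda>x. case x of
       None \<Rightarrow> {((Some (\<gamma>, r), i), lift r \<xi>) | \<gamma> i \<xi> r. ((\<gamma>, i), \<xi>) \<in> r \<and> r \<in> root_choices}
     | Some x \<Rightarrow> {((None, 0), lift (root_chosen x) \<xi>) | \<xi>. ((initial x, 0), \<xi>) \<in> chosen x} \<union>
         {((Some (\<gamma>, r), i), lift r \<xi>) | \<gamma> i \<xi> r. ((\<gamma>, i), \<xi>) \<in> chosen x \<and> r \<in> root_choices}\<rparr>"

lemma D_sel [simp]:
  "syn D = insert None (Some ` (syn A \<times> root_choices))" "inh D = Some ` (inh A \<times> root_choices)"
  "att_in D = \<Gamma>" "att_out D = att_out A" "att_init D = None"
  by (simp_all add: D_def)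

lemma D_root_rules:
  "att_rules D None = {((Some (\<gamma>, r), i), lift r \<xi>) | \<gamma> i \<xi> r. ((\<gamma>, i), \<xi>) \<in> r \<and> r \<in> root_choices}"
  by (simp add: D_def)

lemma D_rules:
  "att_rules D (Some x) = {((None, 0), lift (root_chosen x) \<xi>) | \<xi>. ((initial x, 0), \<xi>) \<in> chosen x} \<union>
     {((Some (\<gamma>, r), i), lift r \<xi>) | \<gamma> i \<xi> r. ((\<gamma>, i), \<xi>) \<in> chosen x \<and> r \<in> root_choices}"
  by (simp add: D_def)

lemma \<Gamma>D:
  assumes "\<Gamma> x = Some k"
  shows "att_in A (base x) = Some k" "chosen x \<subseteq> att_rules A (Some (base x))" "single_valued (chosen x)"
    "initial x \<in> Init" "root_chosen x \<in> root_choices"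
proof -
  from assms have "x \<in> X" "att_in A (base x) = Some k" by (auto simp: \<Gamma>_def split: if_splits)
  moreover from this dec have "dec x \<in> choice_labels A Init" by (auto dest: bij_betwE)
  ultimately show "att_in A (base x) = Some k" "chosen x \<subseteq> att_rules A (Some (base x))"
    "single_valued (chosen x)" "initial x \<in> Init" "root_chosen x \<in> root_choices"
    by (auto simp: choice_labels_def base_def chosen_def initial_def root_chosen_def root_choices_def)
qed

lemma lift_ltrees:
  "\<xi> \<in> ltrees (att_out A) (S \<times> J \<union> S' \<times> J') \<Longrightarrow> r \<in> root_choices \<Longrightarrow>
    lift r \<xi> \<in> ltrees (att_out A) (Some ` (S \<times> root_choices) \<times> J \<union> Some ` (S' \<times> root_choices) \<times> J')"
  unfolding lift_def by (rule ltrees_map, assumption) auto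

text \<open>At an ordinary node the label fixes a single-valued rule set; at the root marker the
  component \<open>r\<close> of the attribute does, so the marker acts deterministically without a
  label of its own.\<close>

lemma datt_D: "datt D"
  unfolding datt_def
proof
  have finR: "finite (att_rules A None)" using att_finite_rules[OF att, of None 1] by (simp add: marked_def)
  then have fin: "finite root_choices" by (simp add: root_choices_def)
  have finX: "finite X" using finite_choice_labels[OF att Init] dec by (simp add: bij_betw_finite)
  show "att D"
  proof (rule attI)
    show "finite (syn D)" "finite (inh D)" "syn D \<inter> inh D = {}" "ranked_alphabet (att_out D)"
      "att_init D \<in> syn D" using att fin by (auto simp: att_def)
    have "dom \<Gamma> \<subseteq> X" by (auto simp: \<Gamma>_def split: if_splits)
    with finX show "ranked_alphabet (att_in D)" by (auto simp: ranked_alphabet_def intro: finite_subset)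
  next
    fix x k assume x: "marked (att_in D) x = Some k"
    show "finite (att_rules D x)"
    proof (cases x)
      case None
      have "att_rules D None \<subseteq> (\<lambda>(((\<gamma>, i), \<xi>), r). ((Some (\<gamma>, r), i), lift r \<xi>)) `
        (att_rules A None \<times> root_choices)"
        unfolding D_root_rules root_choices_def by force
      with None fin finR show ?thesis by (auto intro: finite_subset)
    next
      case (Some y)
      with x have y: "\<Gamma> y = Some k" by (simp add: marked_def)
      have "finite (att_rules A (Some (base y)))"
        using att_finite_rules[OF att, of "Some (base y)"] \<Gamma>D(1)[OF y] by (simp add: marked_def)
      then have finc: "finite (chosen y)" using \<Gamma>D(2)[OF y] by (rule rev_finite_subset)
      have "att_rules D (Some y) \<subseteq> (\<lambda>(l, \<xi>). ((None, 0), lift (root_chosen y) \<xi>)) ` chosen y \<union>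
        (\<lambda>(((\<gamma>, i), \<xi>), r). ((Some (\<gamma>, r), i), lift r \<xi>)) ` (chosen y \<times> root_choices)"
        unfolding D_rules by force
      with Some fin finc show ?thesis by (auto intro: finite_subset)
    qed
  next
    fix x k \<delta> i \<zeta> assume x: "att_in D x = Some k" and r: "((\<delta>, i), \<zeta>) \<in> att_rules D (Some x)"
    from x have x: "\<Gamma> x = Some k" by simp
    note x = x \<Gamma>D[OF x]
    have m: "marked (att_in A) (Some (base x)) = Some k" using x by (simp add: marked_def)
    have *: "(\<gamma> \<in> syn A \<and> i = 0 \<or> \<gamma> \<in> inh A \<and> i \<in> {1..k}) \<and>
      (r \<in> root_choices \<longrightarrow> lift r \<xi> \<in> ltrees (att_out A)
        (Some ` (syn A \<times> root_choices) \<times> {1..k} \<union> Some ` (inh A \<times> root_choices) \<times> {0}))"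
      if "((\<gamma>, i), \<xi>) \<in> chosen x" for \<gamma> i \<xi> r
      using att_ruleD[OF att m] that x(3) lift_ltrees by blast
    from r consider (init) \<xi> where "\<delta> = None" "i = 0" "\<zeta> = lift (root_chosen x) \<xi>" "((initial x, 0), \<xi>) \<in> chosen x"
      | (other) \<gamma> \<xi> r where "\<delta> = Some (\<gamma>, r)" "\<zeta> = lift r \<xi>" "((\<gamma>, i), \<xi>) \<in> chosen x" "r \<in> root_choices"
      unfolding D_rules by blast
    then show "(\<delta> \<in> syn D \<and> i = 0 \<or> \<delta> \<in> inh D \<and> i \<in> {1..k}) \<and>
      \<zeta> \<in> ltrees (att_out D) (syn D \<times> {1..k} \<union> inh D \<times> {0})"
    proof cases
      case init
      with *[of "initial x" 0 \<xi> "root_chosen x"] x(6) show ?thesis by (auto elim: ltrees_mono)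
    next
      case other
      with *[of \<gamma> i \<xi> r] show ?thesis by (auto elim: ltrees_mono)
    qed
  next
    fix \<delta> i \<zeta> assume "((\<delta>, i), \<zeta>) \<in> att_rules D None"
    then obtain \<gamma> r \<xi> where r: "\<delta> = Some (\<gamma>, r)" "\<zeta> = lift r \<xi>" "((\<gamma>, i), \<xi>) \<in> r" "r \<in> root_choices"
      unfolding D_root_rules by blast
    then have "((\<gamma>, i), \<xi>) \<in> att_rules A None" by (auto simp: root_choices_def)
    note d = att_root_ruleD[OF att this]
    then have "lift r \<xi> \<in> ltrees (att_out A) (Some ` (syn A \<times> root_choices) \<times> {1})"
      using lift_ltrees[of \<xi> "syn A" "{1}" "{}" "{}" r] r(4) by simp
    with d r show "\<delta> \<in> inh D \<and> i = 1 \<and> \<zeta> \<in> ltrees (att_out D) (syn D \<times> {1})"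
      by (auto elim: ltrees_mono)
  qed
  show "deterministic D"
    unfolding deterministic_def
  proof (intro ballI allI impI)
    fix x l \<zeta> \<zeta>' assume x: "x \<in> insert None (Some ` dom (att_in D))"
      and r: "(l, \<zeta>) \<in> att_rules D x \<and> (l, \<zeta>') \<in> att_rules D x"
    show "\<zeta> = \<zeta>'"
    proof (cases x)
      case None
      with r show ?thesis by (auto simp: D_root_rules root_choices_def dest: single_valuedD)
    next
      case (Some y)
      with x obtain k where "\<Gamma> y = Some k" by auto
      from \<Gamma>D(3)[OF this] Some r show ?thesis by (auto simp: D_rules dest: single_valuedD)
    qed
  qed
qed

end

section \<open>Relabeled trees and correctness of the choice construction\<close>

lemma node_label_map_tree: "node_label (map_tree g s) v = map_option g (node_label s v)"
  by (induction s v rule: node_label.induct) auto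

lemma mark_map_tree: "mark (map_tree g s) = map_tree (map_option g) (mark s)"
  by (simp add: mark_def tree.map_comp comp_def)

text \<open>The tree is assembled bottom-up from a labeling prescribed node by node;
  \<open>lab\<close> is generalized because each child uses its own shifted node names.\<close>

lemma relabel_exists:
  assumes "s \<in> trees \<Sigma>" "\<And>w \<sigma>. node_label s w = Some \<sigma> \<Longrightarrow> g (lab w \<sigma>) = \<sigma> \<and> \<Gamma> (lab w \<sigma>) = \<Sigma> \<sigma>"
  shows "\<exists>u\<in>trees \<Gamma>. map_tree g u = s \<and> (\<forall>w. node_label u w = (case node_label s w of
    None \<Rightarrow> None | Some \<sigma> \<Rightarrow> Some (lab w \<sigma>)))"
  using assms
proof (induction arbitrary: lab rule: trees.induct)
  case (1 f ts)
  let ?P = "\<lambda>u s lab. u \<in> trees \<Gamma> \<and> map_tree g u = s \<and> (\<forall>w. node_label u w = (case node_label s w of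
    None \<Rightarrow> None | Some \<sigma> \<Rightarrow> Some (lab w \<sigma>)))"
  have "\<exists>u. ?P u (ts ! i) (\<lambda>w. lab (Suc i # w))" if i: "i < length ts" for i
  proof -
    have "g (lab (Suc i # w) \<sigma>) = \<sigma> \<and> \<Gamma> (lab (Suc i # w) \<sigma>) = \<Sigma> \<sigma>" if "node_label (ts ! i) w = Some \<sigma>" for w \<sigma>
      using 1(3)[of "Suc i # w" \<sigma>] i that by simp
    then show ?thesis using 1(2) nth_mem[OF i] by (auto simp: Bex_def)
  qed
  then have "\<forall>i<length ts. \<exists>u. ?P u (ts ! i) (\<lambda>w. lab (Suc i # w))" by blast
  from iffD1[OF choice_iff' this] obtain U where
    U: "\<forall>i<length ts. ?P (U i) (ts ! i) (\<lambda>w. lab (Suc i # w))" ..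
  define us where "us = map U [0..<length ts]"
  have us: "length us = length ts" "\<And>i. i < length ts \<Longrightarrow> ?P (us ! i) (ts ! i) (\<lambda>w. lab (Suc i # w))"
    using U by (simp_all add: us_def)
  have root: "g (lab [] f) = f \<and> \<Gamma> (lab [] f) = \<Sigma> f" using 1(3)[of "[]" f] by simp
  have "\<forall>u\<in>set us. u \<in> trees \<Gamma>" using us by (metis in_set_conv_nth)
  moreover have "map (map_tree g) us = ts" using us by (auto intro!: nth_equalityI)
  moreover have "node_label (Node (lab [] f) us) w = (case node_label (Node f ts) w of
    None \<Rightarrow> None | Some \<sigma> \<Rightarrow> Some (lab w \<sigma>))" for w
  proof (cases w)
    case (Cons i v)
    show ?thesis
    proof (cases "1 \<le> i \<and> i \<le> length ts")
      case True
      then have "i - 1 < length ts" "Suc (i - 1) = i" by auto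
      with us(2)[of "i - 1"] have "node_label (us ! (i - 1)) v = (case node_label (ts ! (i - 1)) v of
        None \<Rightarrow> None | Some \<sigma> \<Rightarrow> Some (lab (i # v) \<sigma>))" by metis
      with True show ?thesis using us(1) unfolding Cons by simp
    qed (use Cons us(1) in auto)
  qed simp
  ultimately show ?case using root 1(1) us(1)
    by (intro bexI[of _ "Node (lab [] f) us"] conjI allI) (auto simp: trees_Node_iff)
qed

lemma lmap_inj: "inj g \<Longrightarrow> lmap g \<xi> = lmap g \<xi>' \<Longrightarrow> \<xi> = \<xi>'"
  using ltree.inj_map[OF inj_on_id, of g] unfolding map_ltree_id[symmetric] by (auto dest: injD)

context choice
begin

lemma lmap_lift:
  assumes "\<And>\<gamma> j. \<phi> (Some (\<gamma>, r), child v j) = (\<gamma>, child v j)"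
  shows "lmap \<phi> (lmap (\<lambda>(\<gamma>', j). (\<gamma>', child v j)) (lift r \<xi>)) = lmap (\<lambda>(\<gamma>', j). (\<gamma>', child v j)) \<xi>"
  unfolding lift_def lmap_lmap by (rule lmap_cong) (auto simp: assms)

text \<open>No consistency between labels at different nodes is required: every stored rule is a
  rule of \<open>A\<close>, so forgetting the stored choices maps any derivation of \<open>D\<close>
  to one of \<open>A\<close>.\<close>

lemma D_sound:
  assumes "u \<in> trees \<Gamma>" "gder (ground D (mark u)) (None, [1]) t"
  shows "\<exists>a\<in>Init. gder (ground A (mark (map_tree base u))) (a, [1]) t"
proof -
  \<comment> \<open>\<open>None\<close> can have rules at every ordinary node, not only at the root
    of \<open>u\<close>, so it is interpreted by the initial attribute stored at the node where it
    stands.\<close>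
  define \<phi> where "\<phi> y = (case fst y of Some (\<gamma>, r) \<Rightarrow> (\<gamma>, snd y)
    | None \<Rightarrow> (initial (the (the (node_label (mark u) (snd y)))), snd y))" for y :: "('q \<times> ('q, 'g) rules) option \<times> nat list"
  have \<phi>: "\<phi> (Some (\<gamma>, r), w) = (\<gamma>, w)" for \<gamma> r w by (simp add: \<phi>_def)
  have "(\<phi> y, lmap \<phi> \<zeta>) \<in> ground A (mark (map_tree base u))" if "(y, \<zeta>) \<in> ground D (mark u)" for y \<zeta>
    using that
  proof (cases rule: groundE)
    case g: (1 v \<tau> \<delta> i \<theta>)
    from trees_node_label[OF mark_trees[OF assms(1)] g(1)] obtain k where
      k: "marked \<Gamma> \<tau> = Some k" by blast
    have label: "node_label (mark (map_tree base u)) v = Some (map_option base \<tau>)"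
      unfolding mark_map_tree node_label_map_tree g(1) by simp
    show ?thesis
    proof (cases \<tau>)
      case None
      with g(2) obtain \<gamma> r \<xi> where r: "\<delta> = Some (\<gamma>, r)" "\<theta> = lift r \<xi>" "((\<gamma>, i), \<xi>) \<in> r" "r \<in> root_choices"
        using D_root_rules by blast
      show ?thesis
      proof (rule groundI[OF label])
        show "((\<gamma>, i), \<xi>) \<in> att_rules A (map_option base \<tau>)"
          using r None by (auto simp: root_choices_def)
      qed (use g r in \<open>auto simp: \<phi> lmap_lift\<close>)
    next
      case (Some x)
      with k have x: "\<Gamma> x = Some k" by (simp add: marked_def)
      from g(2)[unfolded Some D_rules] consider (init) \<xi> where "\<delta> = None" "i = 0" "\<theta> = lift (root_chosen x) \<xi>" "((initial x, 0), \<xi>) \<in> chosen x"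
        | (other) \<gamma> \<xi> r where "\<delta> = Some (\<gamma>, r)" "\<theta> = lift r \<xi>" "((\<gamma>, i), \<xi>) \<in> chosen x" "r \<in> root_choices"
        by blast
      then show ?thesis
      proof cases
        case init
        show ?thesis
        proof (rule groundI[OF label])
          show "((initial x, 0), \<xi>) \<in> att_rules A (map_option base \<tau>)" using init \<Gamma>D(2)[OF x] Some by auto
          show "initial x \<in> syn A \<and> (0::nat) = 0 \<or> initial x \<in> inh A \<and> 0 < (0::nat)" using \<Gamma>D(4)[OF x] Init by auto
          show "\<phi> y = (initial x, child v 0)" using g init Some by (simp add: \<phi>_def child_def)
          show "lmap \<phi> \<zeta> = lmap (\<lambda>(\<gamma>', j). (\<gamma>', child v j)) \<xi>" using g(5) init(3) by (simp add: \<phi> lmap_lift)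
        qed
      next
        case other
        show ?thesis
        proof (rule groundI[OF label])
          show "((\<gamma>, i), \<xi>) \<in> att_rules A (map_option base \<tau>)" using other \<Gamma>D(2)[OF x] Some by auto
        qed (use g other in \<open>auto simp: \<phi> lmap_lift\<close>)
      qed
    qed
  qed
  from gder_map[of "ground D (mark u)" \<phi>, OF this assms(2)]
  have "gder (ground A (mark (map_tree base u))) (\<phi> (None, [1])) t" .
  moreover obtain f us where u: "u = Node f us" by (cases u)
  then have "\<phi> (None, [1]) = (initial f, [1])" by (simp add: \<phi>_def mark_def)
  moreover have "initial f \<in> Init" using assms(1) u \<Gamma>D(4) by (auto simp: trees_Node_iff)
  ultimately show ?thesis by auto
qed

text \<open>A uniform choice \<open>C\<close> for the whole grammar is cut into local pieces:
  \<open>rc v\<close> collects the rules whose instances at \<open>v\<close> lie in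
  \<open>C\<close>, and the label of that node stores them. The output may differ from
  \<open>t\<close>; only definedness is kept.\<close>

lemma D_complete:
  assumes s: "s \<in> trees (att_in A)" and a: "a \<in> Init" and der: "gder (ground A (mark s)) (a, [1]) t"
  shows "\<exists>u\<in>trees \<Gamma>. map_tree base u = s \<and> (\<exists>t. gder (ground D (mark u)) (None, [1]) t)"
proof -
  obtain C where C: "C \<subseteq> ground A (mark s)" "single_valued C"
    "\<And>x t. gder (ground A (mark s)) x t \<Longrightarrow> \<exists>t'. gder C x t'"
    using grammar_uniformization[of "ground A (mark s)"] by metis
  define gl :: "nat list \<Rightarrow> ('g, 'q \<times> nat) ltree \<Rightarrow> ('g, 'q \<times> nat list) ltree"
    where "gl v = lmap (\<lambda>(\<gamma>', j). (\<gamma>', child v j))" for v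
  \<comment> \<open>At a fixed node the instance of a right-hand side determines the right-hand
    side; this makes the local pieces single-valued.\<close>
  have "inj (\<lambda>(\<gamma>' :: 'q, j). (\<gamma>', child v j))" for v by (auto simp: inj_def child_inj)
  then have gl_inj: "gl v \<xi> = gl v \<xi>' \<Longrightarrow> \<xi> = \<xi>'" for v \<xi> \<xi>'
    unfolding gl_def by (rule lmap_inj)
  define rc where "rc v \<tau> = {((\<gamma>, i), \<xi>) | \<gamma> i \<xi>. ((\<gamma>, i), \<xi>) \<in> att_rules A \<tau> \<and>
    ((\<gamma>, child v i), gl v \<xi>) \<in> C}" for v \<tau>
  have rc: "rc v \<tau> \<subseteq> att_rules A \<tau>" "single_valued (rc v \<tau>)" for v \<tau>
    using C(2) gl_inj by (auto simp: rc_def intro!: single_valuedI dest: single_valuedD)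
  define r0 where "r0 = rc [] None"
  have r0: "r0 \<in> root_choices" using rc by (simp add: r0_def root_choices_def)
  \<comment> \<open>A node \<open>w\<close> of \<open>s\<close> is the node \<open>1 # w\<close> of
    \<open>mark s\<close>. All labels carry the same \<open>a\<close> and \<open>r0\<close>.\<close>
  define lab where "lab w \<sigma> = inv_into X dec (\<sigma>, rc (1 # w) (Some \<sigma>), a, r0)" for w \<sigma>
  have lab: "lab w \<sigma> \<in> X \<and> dec (lab w \<sigma>) = (\<sigma>, rc (1 # w) (Some \<sigma>), a, r0)"
    if "\<sigma> \<in> dom (att_in A)" for w \<sigma>
  proof -
    have "(\<sigma>, rc (1 # w) (Some \<sigma>), a, r0) \<in> dec ` X"
      using that rc a r0 dec by (simp add: choice_labels_def bij_betw_def root_choices_def)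
    then show ?thesis unfolding lab_def by (simp add: inv_into_into f_inv_into_f)
  qed
  have dom: "\<sigma> \<in> dom (att_in A)" if "node_label s w = Some \<sigma>" for w \<sigma>
    using trees_node_label[OF s that] by auto
  have "\<exists>u\<in>trees \<Gamma>. map_tree base u = s \<and> (\<forall>w. node_label u w = (case node_label s w of
    None \<Rightarrow> None | Some \<sigma> \<Rightarrow> Some (lab w \<sigma>)))"
    by (rule relabel_exists[OF s]) (use lab[OF dom] in \<open>simp add: base_def \<Gamma>_def\<close>)
  then obtain u where u: "u \<in> trees \<Gamma>" "map_tree base u = s"
    "\<And>w. node_label u w = (case node_label s w of None \<Rightarrow> None | Some \<sigma> \<Rightarrow> Some (lab w \<sigma>))" by blast
  define \<phi> where "\<phi> y = (Some (fst y, r0), snd y)" for y :: "'q \<times> nat list"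
  have lift: "lmap \<phi> (gl v \<xi>) = lmap (\<lambda>(\<gamma>', j). (\<gamma>', child v j)) (lift r0 \<xi>)" for v \<xi>
    unfolding gl_def lift_def lmap_lmap by (rule lmap_cong) (auto simp: \<phi>_def)
  have label: "\<exists>w. v = 1 # w \<and> node_label (mark u) v = Some (Some (lab w \<sigma>)) \<and>
    chosen (lab w \<sigma>) = rc v (Some \<sigma>) \<and> initial (lab w \<sigma>) = a \<and> root_chosen (lab w \<sigma>) = r0"
    if "node_label (mark s) v = Some (Some \<sigma>)" for v \<sigma>
  proof -
    from that obtain w where w: "v = 1 # w" "node_label s w = Some \<sigma>"
      unfolding node_label_mark_Cons by blast
    then have "node_label u w = Some (lab w \<sigma>)" using u(3) by simp
    then have "node_label (mark u) v = Some (Some (lab w \<sigma>))"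
      unfolding node_label_mark_Cons using w by simp
    with w lab[OF dom[OF w(2)], of w] show ?thesis
      by (simp add: chosen_def initial_def root_chosen_def)
  qed
  have transfer: "(\<phi> y, lmap \<phi> \<zeta>) \<in> ground D (mark u)" if "(y, \<zeta>) \<in> C" for y \<zeta>
  proof -
    from that C(1) have "(y, \<zeta>) \<in> ground A (mark s)" by blast
    then show ?thesis
    proof (cases rule: groundE)
      case g: (1 v \<tau> \<gamma> i \<xi>)
      have in_rc: "((\<gamma>, i), \<xi>) \<in> rc v \<tau>" using g that by (simp add: rc_def gl_def)
      have \<zeta>: "lmap \<phi> \<zeta> = lmap (\<lambda>(\<gamma>', j). (\<gamma>', child v j)) (lift r0 \<xi>)"
        using lift g(5) by (simp add: gl_def)
      have \<gamma>: "Some (\<gamma>, r0) \<in> syn D \<and> i = 0 \<or> Some (\<gamma>, r0) \<in> inh D \<and> 0 < i" using g(3) r0 by auto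
      have y: "\<phi> y = (Some (\<gamma>, r0), child v i)" using g(4) by (simp add: \<phi>_def)
      show ?thesis
      proof (cases \<tau>)
        case None
        have "v = []"
        proof (rule ccontr)
          assume "v \<noteq> []"
          with g(1) None show False
            by (cases v) (auto simp: mark_def node_label_map_tree split: if_splits)
        qed
        with in_rc None have "((\<gamma>, i), \<xi>) \<in> r0" by (simp add: r0_def)
        with r0 have "((Some (\<gamma>, r0), i), lift r0 \<xi>) \<in> att_rules D None"
          unfolding D_root_rules by blast
        then show ?thesis using \<open>v = []\<close> by (intro groundI[OF _ _ \<gamma> y \<zeta>]) (auto simp: mark_def)
      next
        case (Some \<sigma>)
        with g(1) label obtain w where w: "node_label (mark u) v = Some (Some (lab w \<sigma>))"
          "chosen (lab w \<sigma>) = rc v (Some \<sigma>)" by blast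
        with in_rc Some r0 have "((Some (\<gamma>, r0), i), lift r0 \<xi>) \<in> att_rules D (Some (lab w \<sigma>))"
          unfolding D_rules by blast
        with w(1) show ?thesis by (intro groundI[OF _ _ \<gamma> y \<zeta>])
      qed
    qed
  qed
  \<comment> \<open>\<open>None\<close> imitates only the first step from \<open>a\<close>, and the
    leaves of its right-hand side are tagged attributes again. So the derivation is unfolded once
    and the rest is simulated by \<open>transfer\<close>.\<close>
  from C(3) der obtain t' where "gder C (a, [1]) t'" by blast
  then obtain \<zeta> where \<zeta>: "((a, [1]), \<zeta>) \<in> C" "deval (gder C) \<zeta> t'" by (auto elim: gderE)
  then have "((a, [1]), \<zeta>) \<in> ground A (mark s)" using C(1) by blast
  then have "gder (ground D (mark u)) (None, [1]) t'"
  proof (cases rule: groundE)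
    case g: (1 v \<tau> \<gamma> i \<xi>)
    have "a \<in> syn A" "syn A \<inter> inh A = {}" using a Init att by (auto simp: att_def)
    with g(3,4) have i: "i = 0" "v = [1]" "\<gamma> = a" by (auto simp: child_def)
    obtain \<sigma> where \<tau>: "\<tau> = Some \<sigma>"
      using g(1) i(2) by (cases s) (auto simp: mark_def)
    with g(1) label obtain w where w: "node_label (mark u) v = Some (Some (lab w \<sigma>))"
      "chosen (lab w \<sigma>) = rc v (Some \<sigma>)" "initial (lab w \<sigma>) = a" "root_chosen (lab w \<sigma>) = r0" by blast
    have "((a, 0), \<xi>) \<in> rc v (Some \<sigma>)" using g \<tau> i \<zeta>(1) by (simp add: rc_def gl_def child_def)
    with w have "((None, 0), lift r0 \<xi>) \<in> att_rules D (Some (lab w \<sigma>))" unfolding D_rules by blast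
    then have "((None, [1]), lmap (\<lambda>(\<gamma>', j). (\<gamma>', child v j)) (lift r0 \<xi>)) \<in> ground D (mark u)"
      using i w(1) by (intro groundI) (auto simp: child_def)
    moreover have "deval (gder (ground D (mark u))) (lmap \<phi> (gl v \<xi>)) t'"
      unfolding deval_map using \<zeta>(2) g(5) gder_map[of C \<phi>, OF transfer]
      by (auto simp: gl_def elim: deval_cong_leaves)
    ultimately show ?thesis unfolding lift by (rule gder.intros)
  qed
  with u show ?thesis by blast
qed

end


section \<open>Relabelings\<close>

lemma list_all2_map_cong: "map h ts = map h ts' \<Longrightarrow> list_all2 (\<lambda>q t. P q (h t)) qs ts = list_all2 (\<lambda>q t. P q (h t)) qs ts'"
  by (metis list.rel_map(2))

section \<open>Runs of bottom-up relabelings\<close>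

lemma bu_run_Node_iff: "bu_run B (Node \<sigma> ts) p u \<longleftrightarrow> (\<exists>ps \<sigma>' us. u = Node \<sigma>' us \<and>
    length ps = length ts \<and> length us = length ts \<and>
    (\<forall>i<length ts. bu_run B (ts ! i) (ps ! i) (us ! i)) \<and> bu_rules B \<sigma> ps = Some (p, \<sigma>'))"
  by (subst bu_run.simps) auto

lemma bu_run_unique: "bu_run B s p u \<Longrightarrow> bu_run B s p' u' \<Longrightarrow> p = p' \<and> u = u'"
proof (induction s arbitrary: p u p' u')
  case (Node \<sigma> ts)
  from Node.prems(1) obtain ps \<rho> us where 1: "u = Node \<rho> us" "length ps = length ts"
    "length us = length ts" "\<forall>i<length ts. bu_run B (ts ! i) (ps ! i) (us ! i)"
    "bu_rules B \<sigma> ps = Some (p, \<rho>)" unfolding bu_run_Node_iff by blast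
  from Node.prems(2) obtain ps' \<rho>' us' where 2: "u' = Node \<rho>' us'" "length ps' = length ts"
    "length us' = length ts" "\<forall>i<length ts. bu_run B (ts ! i) (ps' ! i) (us' ! i)"
    "bu_rules B \<sigma> ps' = Some (p', \<rho>')" unfolding bu_run_Node_iff by blast
  have "ps ! i = ps' ! i \<and> us ! i = us' ! i" if "i < length ts" for i
    using 1(4) 2(4) that by (intro Node.IH[OF nth_mem]) auto
  with 1 2 have "ps = ps'" "us = us'" by (auto intro!: nth_equalityI)
  with 1 2 show ?case by simp
qed

lemma bu_run_trees:
  assumes "bu_relabeling B"
  shows "bu_run B s p u \<Longrightarrow> s \<in> trees (bu_in B) \<and> u \<in> trees (bu_out B)"
proof (induction rule: bu_run.induct)
  case (1 ps ts us \<sigma> p \<sigma>')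
  with assms have "bu_in B \<sigma> = Some (length ps)" "bu_out B \<sigma>' = Some (length ps)"
    unfolding bu_relabeling_def by blast+
  with 1 show ?case by (auto simp: trees_Node_iff in_set_conv_nth)
qed

section \<open>Runs of top-down relabelings\<close>

definition td_rhs :: "'g \<Rightarrow> 'q list \<Rightarrow> ('g, 'q \<times> nat) ltree" where
  "td_rhs f qs = Op f (map (\<lambda>i. Leaf (qs ! i, Suc i)) [0..<length qs])"

lemma td_rhs_inj:
  assumes "td_rhs f qs = td_rhs f' qs'"
  shows "f = f' \<and> qs = qs'"
proof -
  from assms have f: "f = f'" and args: "map (\<lambda>i. Leaf (qs ! i, Suc i)) [0..<length qs] =
    map (\<lambda>i. Leaf (qs' ! i, Suc i) :: ('a, 'b \<times> nat) ltree) [0..<length qs']"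
    by (simp_all only: td_rhs_def ltree.inject)
  from arg_cong[OF args, of length] have len: "length qs = length qs'" by simp
  have "qs ! i = qs' ! i" if "i < length qs" for i
    using arg_cong[OF args, of "\<lambda>xs. xs ! i"] len that by simp
  with f len show ?thesis by (simp add: list_eq_iff_nth_eq)
qed

inductive td_run :: "('q, 'f, 'g) att \<Rightarrow> 'q \<Rightarrow> 'f tree \<Rightarrow> 'g tree \<Rightarrow> bool" for T where
  "((q, 0), td_rhs f qs) \<in> att_rules T (Some \<sigma>) \<Longrightarrow> length qs = length ts \<Longrightarrow>
    length us = length ts \<Longrightarrow> \<forall>i<length ts. td_run T (qs ! i) (ts ! i) (us ! i) \<Longrightarrow>
    td_run T q (Node \<sigma> ts) (Node f us)"

lemma td_run_Node_iff: "td_run T q (Node \<sigma> ts) u \<longleftrightarrow> (\<exists>f qs us. u = Node f us \<and>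
    ((q, 0), td_rhs f qs) \<in> att_rules T (Some \<sigma>) \<and> length qs = length ts \<and> length us = length ts \<and>
    (\<forall>i<length ts. td_run T (qs ! i) (ts ! i) (us ! i)))"
  by (subst td_run.simps) auto

lemma td_ruleD:
  assumes "td_relabeling T" "att_in T \<sigma> = Some k" "((q, i), \<xi>) \<in> att_rules T (Some \<sigma>)"
  shows "q \<in> syn T \<and> i = 0 \<and> (\<exists>f qs. \<xi> = td_rhs f qs \<and> att_out T f = Some k \<and> length qs = k \<and> set qs \<subseteq> syn T)"
proof -
  have T: "att T" "inh T = {}" using assms(1) by (auto simp: td_relabeling_def datt_def)
  have "marked (att_in T) (Some \<sigma>) = Some k" using assms(2) by (simp add: marked_def)
  note D = att_ruleD[OF T(1) this assms(3)]
  from assms(1,2) have "\<forall>(l, \<xi>)\<in>att_rules T (Some \<sigma>). \<exists>f qs. att_out T f = Some k \<and> length qs = k \<and>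
    \<xi> = Op f (map (\<lambda>i. Leaf (qs ! i, Suc i)) [0..<k])" by (simp add: td_relabeling_def)
  from bspec[OF this assms(3)] obtain f qs where f: "att_out T f = Some k" "length qs = k" "\<xi> = td_rhs f qs"
    by (auto simp: td_rhs_def)
  have "set qs \<subseteq> syn T"
  proof
    fix q assume "q \<in> set qs"
    then obtain i where "i < length qs" "q = qs ! i" by (auto simp: in_set_conv_nth)
    then have "(q, Suc i) \<in> set2_ltree \<xi>" by (auto simp: f(3) td_rhs_def)
    with ltrees_leaves[OF D(2)] show "q \<in> syn T" by auto
  qed
  with D(1) f T(2) show ?thesis by auto
qed

text \<open>The premise on node labels says that \<open>u\<close> is the subtree of \<open>S\<close>
  at \<open>v\<close>; in this form it passes to the children by extending node strings.\<close>

lemma td_run_imp_gder: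
  assumes "td_relabeling T"
  shows "td_run T q u t \<Longrightarrow> u \<in> trees (att_in T) \<Longrightarrow>
    (\<And>w. node_label S (v @ w) = node_label (map_tree Some u) w) \<Longrightarrow> gder (ground T S) (q, v) t"
proof (induction u arbitrary: q t v)
  case (Node \<sigma> ts)
  from Node.prems(1) obtain f qs us where r: "t = Node f us"
    "((q, 0), td_rhs f qs) \<in> att_rules T (Some \<sigma>)" "length qs = length ts" "length us = length ts"
    "\<forall>i<length ts. td_run T (qs ! i) (ts ! i) (us ! i)" unfolding td_run_Node_iff by blast
  from Node.prems(2) have "att_in T \<sigma> = Some (length ts)" by (simp add: trees_Node_iff)
  from td_ruleD[OF assms this r(2)] have q: "q \<in> syn T" by simp
  have sub: "gder (ground T S) (qs ! i, v @ [Suc i]) (us ! i)" if i: "i < length ts" for i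
  proof (rule Node.IH)
    show "ts ! i \<in> set ts" "td_run T (qs ! i) (ts ! i) (us ! i)" using i r by auto
    show "ts ! i \<in> trees (att_in T)" using Node.prems(2) i by (simp add: trees_Node_iff)
    show "node_label S ((v @ [Suc i]) @ w) = node_label (map_tree Some (ts ! i)) w" for w
      using Node.prems(3)[of "Suc i # w"] i by simp
  qed
  show ?case
  proof (rule gder.intros)
    show "((q, v), lmap (\<lambda>(\<gamma>', j). (\<gamma>', child v j)) (td_rhs f qs)) \<in> ground T S"
      using Node.prems(3)[of "[]"] r(2) q by (intro groundI) (auto simp: child_def)
    show "deval (gder (ground T S)) (lmap (\<lambda>(\<gamma>', j). (\<gamma>', child v j)) (td_rhs f qs)) t"
      using sub r by (auto simp: td_rhs_def deval_Op_iff list_all2_conv_all_nth child_def)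
  qed
qed

lemma gder_imp_td_run:
  assumes "td_relabeling T"
  shows "gder (ground T S) x t \<Longrightarrow> u \<in> trees (att_in T) \<Longrightarrow>
    (\<And>w. node_label S (snd x @ w) = node_label (map_tree Some u) w) \<Longrightarrow> td_run T (fst x) u t"
proof (induction arbitrary: u rule: gder.induct)
  case (1 x \<zeta> t)
  obtain \<sigma> ts where u: "u = Node \<sigma> ts" by (cases u)
  with 1(3) have \<sigma>: "att_in T \<sigma> = Some (length ts)" by (simp add: trees_Node_iff)
  from 1(1) show ?case
  proof (cases rule: groundE)
    case g: (1 v \<tau> \<gamma> i \<xi>)
    have i: "i = 0" "x = (\<gamma>, v)" using g(3,4) assms by (auto simp: td_relabeling_def child_def)
    with g(1) 1(4)[of "[]"] u have \<tau>: "\<tau> = Some \<sigma>" by simp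
    from td_ruleD[OF assms \<sigma> g(2)[unfolded \<tau>]] obtain f qs where
      f: "\<xi> = td_rhs f qs" "length qs = length ts" by blast
    from 1(2) g(5) f obtain us where us: "t = Node f us" "length us = length ts"
      and run: "\<forall>i<length ts. gder (ground T S) (qs ! i, v @ [Suc i]) (us ! i) \<and>
        (\<forall>u. u \<in> trees (att_in T) \<longrightarrow>
          (\<forall>w. node_label S (snd (qs ! i, v @ [Suc i]) @ w) = node_label (map_tree Some u) w) \<longrightarrow>
          td_run T (fst (qs ! i, v @ [Suc i])) u (us ! i))"
      by (auto simp: td_rhs_def deval_Op_iff list_all2_conv_all_nth child_def)
    have "td_run T (qs ! i) (ts ! i) (us ! i)" if j: "i < length ts" for i
    proof -
      have "node_label S (v @ Suc i # w) = node_label (map_tree Some (ts ! i)) w" for w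
        using 1(4)[of "Suc i # w"] i(2) u j by simp
      moreover have "ts ! i \<in> trees (att_in T)" using 1(3) u j by (simp add: trees_Node_iff)
      ultimately show ?thesis using run j by simp
    qed
    with g(2) i \<tau> f us u show ?thesis by (auto simp: td_run_Node_iff)
  qed
qed

lemma td_trans_iff:
  assumes "td_relabeling T"
  shows "(s, t) \<in> att_trans T \<longleftrightarrow> s \<in> trees (att_in T) \<and> td_run T (att_init T) s t"
proof -
  have T: "att T" using assms by (auto simp: td_relabeling_def datt_def)
  have sub: "node_label (mark s) ([1] @ w) = node_label (map_tree Some s) w" for w
    by (simp add: mark_def)
  show ?thesis
    unfolding att_trans_iff[OF T]
    using gder_imp_td_run[OF assms, of "mark s" "(att_init T, [1])" t s] td_run_imp_gder[OF assms, of "att_init T" s t "mark s" "[1]"] sub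
    by auto
qed

lemma dattU_single_valued:
  assumes "dattU M"
  shows "single_valued (attU_trans M)"
proof -
  have "single_valued (bu_trans (la_bu (attU_la M)))"
    by (auto simp: bu_trans_def single_valued_def dest: bu_run_unique)
  moreover have "single_valued (att_trans (la_td (attU_la M)))" "single_valued (att_trans (attU_att M))"
    using assms by (auto intro!: datt_single_valued simp: dattU_def attU_def lookaround_def td_relabeling_def datt_def)
  ultimately show ?thesis unfolding attU_trans_def la_trans_def by (intro single_valued_relcomp)
qed


section \<open>Nondeterministic relabelings and their uniformization by look-around\<close>

text \<open>A transition \<open>(\<sigma>, qs, q, \<gamma>)\<close> reads \<open>\<sigma>\<close>
  over child states \<open>qs\<close>, moves to \<open>q\<close> and writes \<open>\<gamma>\<close>;
  state and output may both be nondeterministic.\<close>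

inductive nrun :: "('f \<times> 's list \<times> 's \<times> 'g) set \<Rightarrow> 'f tree \<Rightarrow> 's \<Rightarrow> 'g tree \<Rightarrow> bool" for R where
  "(\<sigma>, qs, q, \<gamma>) \<in> R \<Longrightarrow> length qs = length ts \<Longrightarrow> length us = length ts \<Longrightarrow>
    \<forall>i<length ts. nrun R (ts ! i) (qs ! i) (us ! i) \<Longrightarrow> nrun R (Node \<sigma> ts) q (Node \<gamma> us)"

lemma nrun_Node_iff: "nrun R (Node \<sigma> ts) q u \<longleftrightarrow> (\<exists>qs \<gamma> us. u = Node \<gamma> us \<and> (\<sigma>, qs, q, \<gamma>) \<in> R \<and>
    length qs = length ts \<and> length us = length ts \<and> (\<forall>i<length ts. nrun R (ts ! i) (qs ! i) (us ! i)))"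
  by (subst nrun.simps) auto

definition reach :: "('f \<times> 's list \<times> 's \<times> 'g) set \<Rightarrow> 'f tree \<Rightarrow> 's set" where
  "reach R s = {q. \<exists>u. nrun R s q u}"

lemma reach_Node:
  "q \<in> reach R (Node \<sigma> ts) \<longleftrightarrow>
    (\<exists>qs \<gamma>. (\<sigma>, qs, q, \<gamma>) \<in> R \<and> list_all2 (\<lambda>q t. q \<in> reach R t) qs ts)"
proof
  assume "q \<in> reach R (Node \<sigma> ts)"
  then obtain qs \<gamma> us where "(\<sigma>, qs, q, \<gamma>) \<in> R" "length qs = length ts"
    "\<forall>i<length ts. nrun R (ts ! i) (qs ! i) (us ! i)"
    by (auto simp: reach_def nrun_Node_iff)
  then have "(\<sigma>, qs, q, \<gamma>) \<in> R" "list_all2 (\<lambda>q t. q \<in> reach R t) qs ts"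
    by (auto simp: reach_def list_all2_conv_all_nth)
  then show "\<exists>qs \<gamma>. (\<sigma>, qs, q, \<gamma>) \<in> R \<and> list_all2 (\<lambda>q t. q \<in> reach R t) qs ts" by blast
next
  assume "\<exists>qs \<gamma>. (\<sigma>, qs, q, \<gamma>) \<in> R \<and> list_all2 (\<lambda>q t. q \<in> reach R t) qs ts"
  then obtain qs \<gamma> where q: "(\<sigma>, qs, q, \<gamma>) \<in> R" "length qs = length ts"
    "\<forall>i<length ts. \<exists>u. nrun R (ts ! i) (qs ! i) u"
    by (auto simp: reach_def list_all2_conv_all_nth)
  from iffD1[OF choice_iff' q(3)] obtain U where "\<forall>i<length ts. nrun R (ts ! i) (qs ! i) (U i)" ..
  with q have "nrun R (Node \<sigma> ts) q (Node \<gamma> (map U [0..<length ts]))"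
    by (intro nrun.intros) auto
  then show "q \<in> reach R (Node \<sigma> ts)" by (auto simp: reach_def)
qed

text \<open>The subset construction: the set of states reachable at a node depends only on its
  symbol and the sets at its children.\<close>

lemma tree_congruence_reach:
  assumes "finite R"
  shows "tree_congruence (reach R)"
proof -
  have "q \<in> (\<lambda>(\<sigma>, qs, q, \<gamma>). q) ` R" if "q \<in> reach R s" for q s
    using that by (cases s) (force simp: reach_Node)
  then have "range (reach R) \<subseteq> Pow ((\<lambda>(\<sigma>, qs, q, \<gamma>). q) ` R)" by blast
  then have "finite (range (reach R))" by (rule finite_subset) (simp add: assms)
  moreover have "reach R (Node f ts) = reach R (Node f ts')" if "map (reach R) ts = map (reach R) ts'" for f ts ts'
    using list_all2_map_cong[OF that, of "(\<in>)"] by (auto simp: reach_Node)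
  ultimately show ?thesis unfolding tree_congruence_def by blast
qed

text \<open>An infinite symbol type has room to code any finite set of labels; this is where
  infinity of the type enters.\<close>

lemma finite_encoding:
  assumes "finite Y"
  obtains X :: "'a :: infinite set" and d where "finite X" "bij_betw d X Y"
proof -
  obtain X :: "'a set" where "finite X" "card X = card Y"
    using infinite_arbitrarily_large[OF infinite_UNIV] by blast
  with assms that show thesis using finite_same_card_bij by blast
qed

text \<open>The bottom-up relabeling annotates every node with the sets of states reachable at its
  children (encoded by \<open>h\<close>); the top-down relabeling then resolves the nondeterminism, using the
  new initial state \<open>None\<close> to choose the final state at the root.\<close>

locale relabeling =
  fixes \<Sigma> \<Gamma> :: "'a alphabet" and R :: "('a \<times> 's :: countable list \<times> 's \<times> 'a) set" and F :: "'s set"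
    and h :: "'a tree \<Rightarrow> nat" and X :: "'a set" and dec :: "'a \<Rightarrow> 'a \<times> nat list"
  assumes alphabets: "ranked_alphabet \<Sigma>" "ranked_alphabet \<Gamma>" and fin: "finite R"
    and rank: "\<And>\<sigma> qs q \<gamma>. (\<sigma>, qs, q, \<gamma>) \<in> R \<Longrightarrow> \<Sigma> \<sigma> = Some (length qs) \<and> \<Gamma> \<gamma> = Some (length qs)"
    and h: "tree_congruence h" "\<And>s s'. h s = h s' \<longleftrightarrow> reach R s = reach R s'"
    and dec: "finite X" "bij_betw dec X {(\<sigma>, ps). \<Sigma> \<sigma> = Some (length ps) \<and> set ps \<subseteq> range h}"
begin

definition \<Omega> :: "'a alphabet" where
  "\<Omega> x = (if x \<in> X then Some (length (snd (dec x))) else None)"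

definition B :: "(nat, 'a, 'a) bu" where
  "B = \<lparr>bu_states = range h, bu_in = \<Sigma>, bu_out = \<Omega>, bu_final = h ` {s. reach R s \<inter> F \<noteq> {}},
     bu_rules = \<lambda>\<sigma> ps. if \<Sigma> \<sigma> = Some (length ps) \<and> set ps \<subseteq> range h
       then Some (hop h \<sigma> ps, inv_into X dec (\<sigma>, ps)) else None\<rparr>"

text \<open>The choices open to \<open>T\<close> in state \<open>\<delta>\<close>, where
  \<open>None\<close> asks for any final state. Child states are limited to those reachable in the
  class annotated for that child, so no choice leads into a dead end.\<close>

definition ok :: "'a \<Rightarrow> 's option \<Rightarrow> 's list \<times> 'a \<Rightarrow> bool" where
  "ok x \<delta> = (\<lambda>(qs, \<gamma>). \<exists>q. (case \<delta> of None \<Rightarrow> q \<in> F | Some q' \<Rightarrow> q = q') \<and> (fst (dec x), qs, q, \<gamma>) \<in> R \<and>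
     list_all2 (\<lambda>q p. \<exists>s. h s = p \<and> q \<in> reach R s) qs (snd (dec x)))"

definition pick :: "'a \<Rightarrow> 's option \<Rightarrow> 's list \<times> 'a" where
  "pick x \<delta> = (SOME y. ok x \<delta> y)"

text \<open>Restricted to targets of transitions, which keeps the set finite although the type of
  states may be infinite.\<close>

definition states :: "'s option set" where
  "states = insert None (Some ` ((\<lambda>(\<sigma>, qs, q, \<gamma>). q) ` R))"

definition T :: "(nat, 'a, 'a) att" where
  "T = \<lparr>syn = to_nat ` states, inh = {}, att_in = \<Omega>, att_out = \<Gamma>, att_init = to_nat (None :: 's option),
     att_rules = \<lambda>x. case x of None \<Rightarrow> {}
       | Some x \<Rightarrow> {((to_nat \<delta>, 0), td_rhs (snd (pick x \<delta>)) (map (to_nat \<circ> Some) (fst (pick x \<delta>)))) | \<delta>.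
           \<delta> \<in> states \<and> (\<exists>y. ok x \<delta> y)}\<rparr>"

lemma T_sel [simp]: "syn T = to_nat ` states" "inh T = {}" "att_in T = \<Omega>" "att_out T = \<Gamma>"
  "att_init T = to_nat (None :: 's option)"
  by (simp_all add: T_def)

lemma B_sel [simp]: "bu_states B = range h" "bu_in B = \<Sigma>" "bu_out B = \<Omega>"
  "bu_final B = h ` {s. reach R s \<inter> F \<noteq> {}}"
  by (simp_all add: B_def)

lemma T_rules: "att_rules T None = {}"
  "((q, i), \<xi>) \<in> att_rules T (Some x) \<longleftrightarrow> (\<exists>\<delta>. q = to_nat \<delta> \<and> i = 0 \<and> \<delta> \<in> states \<and> ok x \<delta> (pick x \<delta>) \<and>
     \<xi> = td_rhs (snd (pick x \<delta>)) (map (to_nat \<circ> Some) (fst (pick x \<delta>))))"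
proof -
  have "(\<exists>y. ok x \<delta> y) \<longleftrightarrow> ok x \<delta> (pick x \<delta>)" for \<delta>
    unfolding pick_def by (metis someI_ex)
  then show "((q, i), \<xi>) \<in> att_rules T (Some x) \<longleftrightarrow> (\<exists>\<delta>. q = to_nat \<delta> \<and> i = 0 \<and> \<delta> \<in> states \<and>
    ok x \<delta> (pick x \<delta>) \<and> \<xi> = td_rhs (snd (pick x \<delta>)) (map (to_nat \<circ> Some) (fst (pick x \<delta>))))"
    by (auto simp: T_def)
qed (simp add: T_def)

lemma dec_inv: "\<Sigma> \<sigma> = Some (length ps) \<Longrightarrow> set ps \<subseteq> range h \<Longrightarrow>
    inv_into X dec (\<sigma>, ps) \<in> X \<and> dec (inv_into X dec (\<sigma>, ps)) = (\<sigma>, ps)"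
  using dec(2) by (simp add: bij_betw_def inv_into_into f_inv_into_f)

lemma reach_state: "q \<in> reach R s \<Longrightarrow> Some q \<in> states"
  by (cases s) (force simp: reach_Node states_def)

lemma okD:
  assumes "ok x \<delta> (qs, \<gamma>)"
  shows "\<Gamma> \<gamma> = Some (length qs)" "\<Sigma> (fst (dec x)) = Some (length qs)" "length (snd (dec x)) = length qs"
    "\<forall>q\<in>set qs. Some q \<in> states"
proof -
  from assms obtain q where q: "(fst (dec x), qs, q, \<gamma>) \<in> R"
    "list_all2 (\<lambda>q p. \<exists>s. h s = p \<and> q \<in> reach R s) qs (snd (dec x))" by (auto simp: ok_def)
  from rank[OF q(1)] show "\<Gamma> \<gamma> = Some (length qs)" "\<Sigma> (fst (dec x)) = Some (length qs)" by auto
  from q(2) show "length (snd (dec x)) = length qs" by (simp add: list_all2_lengthD)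
  show "\<forall>q\<in>set qs. Some q \<in> states"
  proof
    fix q assume "q \<in> set qs"
    then obtain i where "i < length qs" "q = qs ! i" by (auto simp: in_set_conv_nth)
    with q(2) obtain s where "q \<in> reach R s" by (auto simp: list_all2_conv_all_nth)
    then show "Some q \<in> states" by (rule reach_state)
  qed
qed

lemma bu_relabeling_B: "bu_relabeling B"
proof -
  have "dom \<Omega> \<subseteq> X" by (auto simp: \<Omega>_def split: if_splits)
  then have "ranked_alphabet \<Omega>" using dec(1) by (auto simp: ranked_alphabet_def intro: finite_subset)
  moreover have "bu_rules B \<sigma> ps = Some (p, \<sigma>') \<Longrightarrow>
    \<Sigma> \<sigma> = Some (length ps) \<and> set ps \<subseteq> range h \<and> p \<in> range h \<and> \<Omega> \<sigma>' = Some (length ps)" for \<sigma> ps p \<sigma>'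
    using dec_inv[of \<sigma> ps] by (auto simp: B_def \<Omega>_def hop_range split: if_splits)
  ultimately show ?thesis
    using h(1) alphabets by (auto simp: bu_relabeling_def tree_congruence_def)
qed

lemma td_relabeling_T: "td_relabeling T"
proof -
  have fin_states: "finite states" using fin by (simp add: states_def)
  have pick: "\<Gamma> (snd (pick x \<delta>)) = Some (length (fst (pick x \<delta>)))" "length (snd (dec x)) = length (fst (pick x \<delta>))"
    "\<forall>q\<in>set (fst (pick x \<delta>)). Some q \<in> states"
    if "ok x \<delta> (pick x \<delta>)" for x \<delta>
    using okD[of x \<delta> "fst (pick x \<delta>)" "snd (pick x \<delta>)"] that by auto
  have "att T"
  proof (rule attI)
    have "dom \<Omega> \<subseteq> X" by (auto simp: \<Omega>_def split: if_splits)
    then show "ranked_alphabet (att_in T)" using dec(1) by (auto simp: ranked_alphabet_def intro: finite_subset)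
    show "finite (att_rules T x)" if "marked (att_in T) x = Some k" for x k
    proof (cases x)
      case (Some y)
      have "att_rules T x \<subseteq> (\<lambda>\<delta>. ((to_nat \<delta>, 0), td_rhs (snd (pick y \<delta>)) (map (to_nat \<circ> Some) (fst (pick y \<delta>))))) ` states"
        using Some by (auto simp: T_rules(2))
      then show ?thesis using fin_states by (meson finite_imageI finite_subset)
    qed (simp add: T_rules)
  next
    fix x k q i \<xi> assume x: "att_in T x = Some k" and "((q, i), \<xi>) \<in> att_rules T (Some x)"
    then obtain \<delta> where \<delta>: "q = to_nat \<delta>" "i = 0" "\<delta> \<in> states" "ok x \<delta> (pick x \<delta>)"
      "\<xi> = td_rhs (snd (pick x \<delta>)) (map (to_nat \<circ> Some) (fst (pick x \<delta>)))" by (auto simp: T_rules)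
    have k: "length (fst (pick x \<delta>)) = k" using x pick(2)[OF \<delta>(4)] by (simp add: \<Omega>_def split: if_splits)
    have "\<xi> \<in> ltrees \<Gamma> (to_nat ` states \<times> {1..k})"
      unfolding \<delta>(5) td_rhs_def using pick[OF \<delta>(4)] k by (auto intro!: ltrees.intros)
    with \<delta> show "(q \<in> syn T \<and> i = 0 \<or> q \<in> inh T \<and> i \<in> {1..k}) \<and>
      \<xi> \<in> ltrees (att_out T) (syn T \<times> {1..k} \<union> inh T \<times> {0})" by auto
  qed (use fin_states alphabets in \<open>auto simp: T_rules states_def\<close>)
  moreover have "deterministic T"
    unfolding deterministic_def
  proof (intro ballI allI impI)
    fix x l \<xi> \<xi>' assume "(l, \<xi>) \<in> att_rules T x \<and> (l, \<xi>') \<in> att_rules T x"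
    then show "\<xi> = \<xi>'" by (cases l; cases x) (auto simp: T_rules)
  qed
  moreover have "\<exists>\<sigma>' qs. \<Gamma> \<sigma>' = Some k \<and> length qs = k \<and> \<xi> = Op \<sigma>' (map (\<lambda>i. Leaf (qs ! i, Suc i)) [0..<k])"
    if x: "\<Omega> x = Some k" and "(l, \<xi>) \<in> att_rules T (Some x)" for x k l \<xi>
  proof -
    from that(2) obtain \<delta> where \<delta>: "ok x \<delta> (pick x \<delta>)"
      "\<xi> = td_rhs (snd (pick x \<delta>)) (map (to_nat \<circ> Some) (fst (pick x \<delta>)))" by (cases l) (auto simp: T_rules)
    have k: "length (fst (pick x \<delta>)) = k" using x pick(2)[OF \<delta>(1)] by (simp add: \<Omega>_def split: if_splits)
    with \<delta> pick(1)[OF \<delta>(1)] show ?thesis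
      by (intro exI[of _ "snd (pick x \<delta>)"] exI[of _ "map (to_nat \<circ> Some) (fst (pick x \<delta>))"]) (simp add: td_rhs_def)
  qed
  ultimately show ?thesis by (auto simp: td_relabeling_def datt_def split: prod.splits)
qed

primrec annotation :: "'a tree \<Rightarrow> 'a tree" where
  "annotation (Node \<sigma> ts) = Node (inv_into X dec (\<sigma>, map h ts)) (map annotation ts)"

lemma bu_run_B: "bu_run B s p u \<longleftrightarrow> s \<in> trees \<Sigma> \<and> p = h s \<and> u = annotation s"
proof (induction s arbitrary: p u)
  case (Node \<sigma> ts)
  show ?case
  proof
    assume "bu_run B (Node \<sigma> ts) p u"
    then obtain ps \<rho> us where 1: "u = Node \<rho> us" "length ps = length ts"
      "length us = length ts" "\<forall>i<length ts. bu_run B (ts ! i) (ps ! i) (us ! i)"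
      "bu_rules B \<sigma> ps = Some (p, \<rho>)" unfolding bu_run_Node_iff by blast
    then have *: "\<forall>i<length ts. ts ! i \<in> trees \<Sigma> \<and> ps ! i = h (ts ! i) \<and> us ! i = annotation (ts ! i)"
      using Node.IH by simp
    then have ps: "ps = map h ts" "us = map annotation ts" using 1 by (auto intro!: nth_equalityI)
    from 1(5) have "\<Sigma> \<sigma> = Some (length ps)" "p = hop h \<sigma> ps" "\<rho> = inv_into X dec (\<sigma>, ps)"
      by (auto simp: B_def split: if_splits)
    with * ps 1(1) show "Node \<sigma> ts \<in> trees \<Sigma> \<and> p = h (Node \<sigma> ts) \<and> u = annotation (Node \<sigma> ts)"
      by (auto simp: trees_Node_iff hop_map[OF h(1)] in_set_conv_nth)
  next
    assume r: "Node \<sigma> ts \<in> trees \<Sigma> \<and> p = h (Node \<sigma> ts) \<and> u = annotation (Node \<sigma> ts)"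
    then have "\<Sigma> \<sigma> = Some (length ts)" "\<forall>t\<in>set ts. t \<in> trees \<Sigma>" by (auto simp: trees_Node_iff)
    then have "bu_rules B \<sigma> (map h ts) = Some (h (Node \<sigma> ts), inv_into X dec (\<sigma>, map h ts))"
      "\<forall>i<length ts. bu_run B (ts ! i) (map h ts ! i) (map annotation ts ! i)"
      using Node.IH by (auto simp: B_def hop_map[OF h(1)])
    with r show "bu_run B (Node \<sigma> ts) p u"
      unfolding bu_run_Node_iff annotation.simps by (metis length_map)
  qed
qed

definition matches :: "'s option \<Rightarrow> 's \<Rightarrow> bool" where
  "matches \<delta> q \<longleftrightarrow> (case \<delta> of None \<Rightarrow> q \<in> F | Some q' \<Rightarrow> q = q')"

lemma ok_Node:
  assumes "Node \<sigma> ts \<in> trees \<Sigma>"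
  shows "ok (inv_into X dec (\<sigma>, map h ts)) \<delta> (qs, \<gamma>) \<longleftrightarrow>
    (\<exists>q. matches \<delta> q \<and> (\<sigma>, qs, q, \<gamma>) \<in> R \<and> list_all2 (\<lambda>q t. q \<in> reach R t) qs ts)"
proof -
  have "dec (inv_into X dec (\<sigma>, map h ts)) = (\<sigma>, map h ts)"
    using dec_inv[of \<sigma> "map h ts"] assms by (auto simp: trees_Node_iff)
  moreover have "(\<exists>s. h s = h t \<and> q \<in> reach R s) \<longleftrightarrow> q \<in> reach R t" for q t using h(2) by blast
  ultimately show ?thesis by (simp add: ok_def matches_def list.rel_map)
qed

lemma td_run_T:
  assumes "s \<in> trees \<Sigma>" "\<delta> \<in> states"
  shows "td_run T (to_nat \<delta>) (annotation s) u \<Longrightarrow> \<exists>q. matches \<delta> q \<and> nrun R s q u"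
  using assms
proof (induction s arbitrary: \<delta> u rule: tree.induct)
  case (Node \<sigma> ts)
  let ?x = "inv_into X dec (\<sigma>, map h ts)"
  from Node.prems(1) obtain f qs us where r: "u = Node f us"
    "((to_nat \<delta>, 0), td_rhs f qs) \<in> att_rules T (Some ?x)" "length qs = length ts" "length us = length ts"
    "\<forall>i<length ts. td_run T (qs ! i) (annotation (ts ! i)) (us ! i)"
    by (auto simp: td_run_Node_iff)
  obtain qs' \<gamma> where pick: "pick ?x \<delta> = (qs', \<gamma>)" by (cases "pick ?x \<delta>")
  with r(2) have ok: "ok ?x \<delta> (qs', \<gamma>)" and "td_rhs f qs = td_rhs \<gamma> (map (to_nat \<circ> Some) qs')"
    by (auto simp: T_rules)
  then have f: "f = \<gamma>" "qs = map (to_nat \<circ> Some) qs'" by (auto dest: td_rhs_inj)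
  from ok obtain q where q: "matches \<delta> q" "(\<sigma>, qs', q, \<gamma>) \<in> R" unfolding ok_Node[OF Node.prems(2)] by blast
  have "nrun R (ts ! i) (qs' ! i) (us ! i)" if i: "i < length ts" for i
  proof -
    have "Some (qs' ! i) \<in> states" using okD(4)[OF ok] i r(3) f by simp
    moreover have "td_run T (to_nat (Some (qs' ! i))) (annotation (ts ! i)) (us ! i)"
      using r(3,5) f i by simp
    moreover have "ts ! i \<in> trees \<Sigma>" using Node.prems(2) i by (simp add: trees_Node_iff)
    ultimately show ?thesis using Node.IH[OF nth_mem[OF i], of "Some (qs' ! i)" "us ! i"] by (auto simp: matches_def)
  qed
  with q r f show ?case by (auto simp: nrun_Node_iff)
qed

text \<open>Reachability is handed down: each child can reach the state that the picked transition
  demands of it, so the top-down pass always continues.\<close>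

lemma td_run_T_exists:
  assumes "s \<in> trees \<Sigma>" "\<delta> \<in> states" "matches \<delta> q" "q \<in> reach R s"
  shows "\<exists>u. td_run T (to_nat \<delta>) (annotation s) u"
  using assms
proof (induction s arbitrary: \<delta> q rule: tree.induct)
  case (Node \<sigma> ts)
  let ?x = "inv_into X dec (\<sigma>, map h ts)"
  from Node.prems(3,4) have "\<exists>y. ok ?x \<delta> y" using ok_Node[OF Node.prems(1)] by (auto simp: reach_Node)
  then have ok: "ok ?x \<delta> (pick ?x \<delta>)" unfolding pick_def by (rule someI_ex)
  obtain qs \<gamma> where pick: "pick ?x \<delta> = (qs, \<gamma>)" by (cases "pick ?x \<delta>")
  from ok pick have reach: "list_all2 (\<lambda>q t. q \<in> reach R t) qs ts" unfolding pick ok_Node[OF Node.prems(1)] by blast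
  have "\<exists>u. td_run T (to_nat (Some (qs ! i))) (annotation (ts ! i)) u" if i: "i < length ts" for i
  proof (rule Node.IH[OF nth_mem[OF i]])
    show "ts ! i \<in> trees \<Sigma>" using Node.prems(1) i by (simp add: trees_Node_iff)
    show "qs ! i \<in> reach R (ts ! i)" using reach i by (simp add: list_all2_conv_all_nth)
    then show "Some (qs ! i) \<in> states" by (rule reach_state)
  qed (simp add: matches_def)
  then have "\<forall>i<length ts. \<exists>u. td_run T (to_nat (Some (qs ! i))) (annotation (ts ! i)) u" by blast
  from iffD1[OF choice_iff' this] obtain U where
    "\<forall>i<length ts. td_run T (to_nat (Some (qs ! i))) (annotation (ts ! i)) (U i)" ..
  moreover have "((to_nat \<delta>, 0), td_rhs \<gamma> (map (to_nat \<circ> Some) qs)) \<in> att_rules T (Some ?x)"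
    using ok pick Node.prems(2) by (auto simp: T_rules)
  moreover have "length qs = length ts" using reach by (simp add: list_all2_lengthD)
  ultimately have "td_run T (to_nat \<delta>) (annotation (Node \<sigma> ts)) (Node \<gamma> (map U [0..<length ts]))"
    unfolding annotation.simps td_run_Node_iff
    by (intro exI[of _ \<gamma>] exI[of _ "map (to_nat \<circ> Some) qs"] exI[of _ "map U [0..<length ts]"]) simp
  then show ?case by blast
qed

definition U :: "(nat, nat, 'a, 'a, 'a) lookaround" where
  "U = \<lparr>la_bu = B, la_td = T\<rparr>"

lemma lookaround_U: "lookaround U"
  by (simp add: lookaround_def U_def bu_relabeling_B td_relabeling_T)

lemma nrun_trees: "nrun R s q u \<Longrightarrow> s \<in> trees \<Sigma>"
  by (induction rule: nrun.induct) (use rank in \<open>fastforce simp: trees_Node_iff in_set_conv_nth\<close>)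

lemma la_trans_U_sound: "(s, u) \<in> la_trans U \<Longrightarrow> \<exists>q\<in>F. nrun R s q u"
proof -
  assume "(s, u) \<in> la_trans U"
  then have "s \<in> trees \<Sigma>" "td_run T (to_nat (None :: 's option)) (annotation s) u"
    by (auto simp: la_trans_def U_def bu_trans_def td_trans_iff[OF td_relabeling_T] bu_run_B)
  from td_run_T[OF this(1) _ this(2)] show ?thesis by (auto simp: states_def matches_def)
qed

lemma la_trans_U_complete:
  assumes "nrun R s q u" "q \<in> F"
  shows "s \<in> Domain (la_trans U)"
proof -
  have s: "s \<in> trees \<Sigma>" using assms(1) by (rule nrun_trees)
  have q: "q \<in> reach R s" using assms(1) by (auto simp: reach_def)
  with assms(2) have final: "h s \<in> bu_final B" by auto
  obtain u' where u': "td_run T (to_nat (None :: 's option)) (annotation s) u'"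
    using td_run_T_exists[OF s _ _ q, of None] assms(2) by (auto simp: states_def matches_def)
  have run: "bu_run B s (h s) (annotation s)" using s by (simp add: bu_run_B)
  with final s have "(s, annotation s) \<in> bu_trans B" by (auto simp: bu_trans_def)
  moreover have "(annotation s, u') \<in> att_trans T"
    using u' bu_run_trees[OF bu_relabeling_B run] by (simp add: td_trans_iff[OF td_relabeling_T])
  ultimately show ?thesis by (auto simp: la_trans_def U_def)
qed

end

lemma relabeling_uniformization:
  fixes \<Sigma> \<Gamma> :: "'a :: infinite alphabet" and R :: "('a \<times> 's :: countable list \<times> 's \<times> 'a) set"
  assumes "ranked_alphabet \<Sigma>" "ranked_alphabet \<Gamma>" "finite R"
    and "\<And>\<sigma> qs q \<gamma>. (\<sigma>, qs, q, \<gamma>) \<in> R \<Longrightarrow> \<Sigma> \<sigma> = Some (length qs) \<and> \<Gamma> \<gamma> = Some (length qs)"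
  obtains U :: "(nat, nat, 'a, 'a, 'a) lookaround" where "lookaround U" "bu_in (la_bu U) = \<Sigma>"
    "att_out (la_td U) = \<Gamma>" "la_trans U \<subseteq> {(s, u). \<exists>q\<in>F. nrun R s q u}"
    "Domain (la_trans U) = {s. reach R s \<inter> F \<noteq> {}}"
proof -
  obtain h :: "'a tree \<Rightarrow> nat" where h: "tree_congruence h" "\<And>s s'. h s = h s' \<longleftrightarrow> reach R s = reach R s'"
    using tree_congruence_encode[OF tree_congruence_reach[OF assms(3)]] by blast
  let ?M = "{(\<sigma>, ps). \<Sigma> \<sigma> = Some (length ps) \<and> set ps \<subseteq> range h}"
  \<comment> \<open>The rank of the symbol fixes the length of the list of child classes, so only
    finitely many annotations exist.\<close>
  have "?M \<subseteq> dom \<Sigma> \<times> (\<Union>k\<in>ran \<Sigma>. {ps. set ps \<subseteq> range h \<and> length ps = k})" by (auto intro: ranI)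
  moreover have "finite (ran \<Sigma>)" "finite (dom \<Sigma>)"
    using assms(1) by (auto simp: ranked_alphabet_def finite_ran)
  moreover have "finite (range h)" using h by (simp add: tree_congruence_def)
  ultimately have "finite ?M" by (auto intro!: finite_lists_length_eq elim!: finite_subset)
  then obtain X :: "'a set" and dec where "finite X" "bij_betw dec X ?M" by (rule finite_encoding)
  then interpret relabeling \<Sigma> \<Gamma> R F h X dec
    using assms h by unfold_locales auto
  show thesis
  proof (rule that)
    show "lookaround U" by (rule lookaround_U)
    show "bu_in (la_bu U) = \<Sigma>" "att_out (la_td U) = \<Gamma>" by (simp_all add: U_def)
    show sound: "la_trans U \<subseteq> {(s, u). \<exists>q\<in>F. nrun R s q u}" using la_trans_U_sound by auto
    show "Domain (la_trans U) = {s. reach R s \<inter> F \<noteq> {}}"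
    proof (intro subset_antisym subsetI CollectI)
      show "reach R s \<inter> F \<noteq> {}" if "s \<in> Domain (la_trans U)" for s
        using that sound by (fastforce simp: reach_def)
      show "s \<in> Domain (la_trans U)" if "s \<in> {s. reach R s \<inter> F \<noteq> {}}" for s
        using that la_trans_U_complete by (auto simp: reach_def)
    qed
  qed
qed


section \<open>Uniformization of transducers with look-around\<close>

text \<open>States consist of the state of \<open>B\<close>, the guessed state of \<open>T\<close> and the class of the output tree
  under \<open>h\<close>. The output tree relabels, along \<open>base\<close>, the output tree of \<open>T\<close>.\<close>

definition refinement ::
  "('p, 'f, 'g) bu \<Rightarrow> ('q, 'g, 'k) att \<Rightarrow> 'c alphabet \<Rightarrow> ('c \<Rightarrow> 'k) \<Rightarrow> ('c tree \<Rightarrow> 's) \<Rightarrow>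
    ('f \<times> ('p \<times> 'q \<times> 's) list \<times> ('p \<times> 'q \<times> 's) \<times> 'c) set" where
  "refinement B T \<Gamma> base h = {(\<sigma>, qs, (p, q, z), x) | \<sigma> qs p q z x \<sigma>'.
     bu_rules B \<sigma> (map fst qs) = Some (p, \<sigma>') \<and>
     ((q, 0), td_rhs (base x) (map (fst \<circ> snd) qs)) \<in> att_rules T (Some \<sigma>') \<and>
     \<Gamma> x = Some (length qs) \<and> z = hop h x (map (snd \<circ> snd) qs) \<and>
     set (map (snd \<circ> snd) qs) \<subseteq> range h}"

lemma refinementI:
  "bu_rules B \<sigma> (map fst qs) = Some (p, \<sigma>') \<Longrightarrow>
    ((q, 0), td_rhs (base x) (map (fst \<circ> snd) qs)) \<in> att_rules T (Some \<sigma>') \<Longrightarrow>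
    \<Gamma> x = Some (length qs) \<Longrightarrow> z = hop h x (map (snd \<circ> snd) qs) \<Longrightarrow>
    set (map (snd \<circ> snd) qs) \<subseteq> range h \<Longrightarrow> (\<sigma>, qs, (p, q, z), x) \<in> refinement B T \<Gamma> base h"
  unfolding refinement_def by blast

lemma refinementE:
  assumes "(\<sigma>, qs, pqz, x) \<in> refinement B T \<Gamma> base h"
  obtains p q \<sigma>' where "pqz = (p, q, hop h x (map (snd \<circ> snd) qs))" "bu_rules B \<sigma> (map fst qs) = Some (p, \<sigma>')"
    "((q, 0), td_rhs (base x) (map (fst \<circ> snd) qs)) \<in> att_rules T (Some \<sigma>')"
    "\<Gamma> x = Some (length qs)" "set (map (snd \<circ> snd) qs) \<subseteq> range h"
  using assms unfolding refinement_def by auto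

context
  fixes B :: "('p, 'f, 'g) bu" and T :: "('q, 'g, 'k) att" and \<Gamma> :: "'c alphabet"
    and base :: "'c \<Rightarrow> 'k" and h :: "'c tree \<Rightarrow> 's"
  assumes B: "bu_relabeling B" and T: "td_relabeling T" and BT: "bu_out B = att_in T"
    and \<Gamma>: "ranked_alphabet \<Gamma>" and h: "tree_congruence h"
begin

lemma refinement_rank:
  assumes "(\<sigma>, qs, q, x) \<in> refinement B T \<Gamma> base h"
  shows "bu_in B \<sigma> = Some (length qs) \<and> \<Gamma> x = Some (length qs)"
  using assms
proof (cases rule: refinementE)
  case (1 p q \<sigma>')
  with B show ?thesis unfolding bu_relabeling_def by fastforce
qed

lemma finite_refinement: "finite (refinement B T \<Gamma> base h)"
proof -
  define Q where "Q = bu_states B \<times> syn T \<times> range h"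
  define K where "K = {qs. set qs \<subseteq> Q \<and> length qs \<in> ran (bu_in B)}"
  have "finite Q" using B T h
    by (auto simp: Q_def bu_relabeling_def td_relabeling_def datt_def att_def tree_congruence_def)
  moreover have "K = (\<Union>k\<in>ran (bu_in B). {qs. set qs \<subseteq> Q \<and> length qs = k})" by (auto simp: K_def)
  moreover have "finite (ran (bu_in B))" "finite (dom (bu_in B))" "finite (dom \<Gamma>)"
    using B \<Gamma> by (auto simp: bu_relabeling_def ranked_alphabet_def intro: finite_ran)
  ultimately have "finite (dom (bu_in B) \<times> K \<times> Q \<times> dom \<Gamma>)" by (simp add: finite_lists_length_eq)
  moreover have "refinement B T \<Gamma> base h \<subseteq> dom (bu_in B) \<times> K \<times> Q \<times> dom \<Gamma>"
  proof
    fix r assume "r \<in> refinement B T \<Gamma> base h"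
    moreover obtain \<sigma> qs pqz x where r: "r = (\<sigma>, qs, pqz, x)" by (cases r) auto
    ultimately have *: "(\<sigma>, qs, pqz, x) \<in> refinement B T \<Gamma> base h" by simp
    note rk = refinement_rank[OF *]
    from * show "r \<in> dom (bu_in B) \<times> K \<times> Q \<times> dom \<Gamma>"
    proof (cases rule: refinementE)
      case (1 p q \<sigma>')
      from B 1(2) have b: "set (map fst qs) \<subseteq> bu_states B" "p \<in> bu_states B" "bu_out B \<sigma>' = Some (length (map fst qs))"
        unfolding bu_relabeling_def by blast+
      from b(3) BT have "att_in T \<sigma>' = Some (length qs)" by simp
      from td_ruleD[OF T this 1(3)] obtain f qs' where f: "q \<in> syn T" "set qs' \<subseteq> syn T"
        "td_rhs (base x) (map (fst \<circ> snd) qs) = td_rhs f qs'" by blast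
      from td_rhs_inj[OF f(3)] have "map (fst \<circ> snd) qs = qs'" by (rule conjunct2)
      with f have t: "q \<in> syn T" "set (map (fst \<circ> snd) qs) \<subseteq> syn T" by blast+
      have "y \<in> Q" if "y \<in> set qs" for y
        using that b(1) t(2) 1(5) by (simp add: Q_def mem_Times_iff image_subset_iff)
      moreover have "pqz \<in> Q" using 1(1) b(2) t(1) by (simp add: Q_def hop_range)
      ultimately show ?thesis using rk r by (auto simp: K_def intro: ranI)
    qed
  qed
  ultimately show ?thesis by (rule rev_finite_subset)
qed

text \<open>Each state component has its own meaning: that of \<open>B\<close> is computed upwards,
  that of \<open>T\<close> is guessed at a node and confirmed by the transition at its parent, and
  the class of \<open>u\<close> is computed along.\<close>

lemma nrun_refinementD:
  "nrun (refinement B T \<Gamma> base h) s pqz u \<Longrightarrow> \<exists>s'. bu_run B s (fst pqz) s' \<and>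
    td_run T (fst (snd pqz)) s' (map_tree base u) \<and> u \<in> trees \<Gamma> \<and> h u = snd (snd pqz)"
proof (induction rule: nrun.induct)
  case (1 \<sigma> qs pqz x ts us)
  from 1(4) have "\<forall>i<length ts. \<exists>s'. bu_run B (ts ! i) (fst (qs ! i)) s' \<and>
    td_run T (fst (snd (qs ! i))) s' (map_tree base (us ! i)) \<and> us ! i \<in> trees \<Gamma> \<and>
    h (us ! i) = snd (snd (qs ! i))" by blast
  from iffD1[OF choice_iff' this] obtain S where
    S: "\<forall>i<length ts. bu_run B (ts ! i) (fst (qs ! i)) (S i) \<and>
      td_run T (fst (snd (qs ! i))) (S i) (map_tree base (us ! i)) \<and> us ! i \<in> trees \<Gamma> \<and>
      h (us ! i) = snd (snd (qs ! i))" ..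
  from 1(1) show ?case
  proof (cases rule: refinementE)
    case r: (1 p q \<sigma>')
    have hs: "map (snd \<circ> snd) qs = map h us" using S 1(2,3) by (intro nth_equalityI) auto
    have "bu_run B (Node \<sigma> ts) p (Node \<sigma>' (map S [0..<length ts]))"
      unfolding bu_run_Node_iff using S 1(2) r(2)
      by (intro exI[of _ "map fst qs"] exI[of _ \<sigma>'] exI[of _ "map S [0..<length ts]"]) simp
    moreover have "td_run T q (Node \<sigma>' (map S [0..<length ts])) (map_tree base (Node x us))"
      unfolding td_run_Node_iff using S 1(2,3) r(3)
      by (intro exI[of _ "base x"] exI[of _ "map (fst \<circ> snd) qs"] exI[of _ "map (map_tree base) us"]) simp
    moreover have "Node x us \<in> trees \<Gamma>"
      using S 1(2,3) r(4) by (auto simp: trees_Node_iff in_set_conv_nth)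
    moreover have "h (Node x us) = hop h x (map (snd \<circ> snd) qs)" using hop_map[OF h] hs by simp
    ultimately show ?thesis using r(1) by auto
  qed
qed

lemma nrun_refinementI:
  "bu_run B s p s' \<Longrightarrow> td_run T q s' (map_tree base u) \<Longrightarrow> u \<in> trees \<Gamma> \<Longrightarrow>
    nrun (refinement B T \<Gamma> base h) s (p, q, h u) u"
proof (induction s arbitrary: p s' q u)
  case (Node \<sigma> ts)
  obtain x us where u: "u = Node x us" by (cases u)
  from Node.prems(1) obtain ps \<sigma>' ss where b: "s' = Node \<sigma>' ss" "length ps = length ts"
    "length ss = length ts" "\<forall>i<length ts. bu_run B (ts ! i) (ps ! i) (ss ! i)"
    "bu_rules B \<sigma> ps = Some (p, \<sigma>')" unfolding bu_run_Node_iff by blast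
  from Node.prems(2) b(1) u obtain qs where t: "((q, 0), td_rhs (base x) qs) \<in> att_rules T (Some \<sigma>')"
    "length qs = length ss" "length us = length ss"
    "\<forall>i<length ss. td_run T (qs ! i) (ss ! i) (map_tree base (us ! i))"
    by (auto simp: td_run_Node_iff)
  define rs where "rs = zip ps (zip qs (map h us))"
  have rs: "map fst rs = ps" "map (fst \<circ> snd) rs = qs" "map (snd \<circ> snd) rs = map h us" "length rs = length ts"
    using b t by (simp_all add: rs_def list_eq_iff_nth_eq)
  have "\<Gamma> x = Some (length us)" using Node.prems(3) u by (simp add: trees_Node_iff)
  then have "(\<sigma>, rs, (p, q, h u), x) \<in> refinement B T \<Gamma> base h"
    using b(2,3,5) t(1,3) u hop_map[OF h, of x us]
    by (intro refinementI[of B _ _ p \<sigma>']) (simp_all only: rs, auto)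
  moreover have "nrun (refinement B T \<Gamma> base h) (ts ! i) (rs ! i) (us ! i)" if i: "i < length ts" for i
  proof -
    have "us ! i \<in> trees \<Gamma>" using Node.prems(3) u i b t by (simp add: trees_Node_iff)
    then have "nrun (refinement B T \<Gamma> base h) (ts ! i) (ps ! i, qs ! i, h (us ! i)) (us ! i)"
      using b t i by (intro Node.IH) auto
    then show ?thesis using i b t by (simp add: rs_def)
  qed
  ultimately show ?case using u rs(4) b t by (auto intro: nrun.intros)
qed

end

text \<open>The look-around of \<open>M\<close>, the guess of the labels and the test that
  \<open>D\<close> is defined on them are merged into one nondeterministic relabeling. A single new
  look-around uniformizes it, so the number of factors does not grow.\<close>

lemma attU_uniformization:
  fixes M :: "'a :: infinite attU"
  assumes M: "attU M" and L: "recognizable L"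
  obtains M' where "dattU M'" "attU_in M' = attU_in M" "attU_out M' = attU_out M"
    "attU_trans M' \<subseteq> attU_trans M" "Range (attU_trans M') \<subseteq> L"
    "Domain (attU_trans M') = {s. \<exists>t\<in>L. (s, t) \<in> attU_trans M}"
    "recognizable (Domain (attU_trans M'))"
proof -
  define B where "B = la_bu (attU_la M)"
  define T where "T = la_td (attU_la M)"
  define A where "A = attU_att M"
  have B: "bu_relabeling B" and T: "td_relabeling T" and BT: "bu_out B = att_in T"
    and A: "att A" and TA: "att_out T = att_in A"
    using M by (auto simp: attU_def lookaround_def B_def T_def A_def)
  have attT: "att T" using T by (simp add: td_relabeling_def datt_def)
  have trans_M: "(s, t) \<in> attU_trans M \<longleftrightarrow> (\<exists>p\<in>bu_final B. \<exists>s' s''. bu_run B s p s' \<and>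
    td_run T (att_init T) s' s'' \<and> s'' \<in> trees (att_in A) \<and> gder (ground A (mark s'')) (att_init A, [1]) t)" for s t
  proof
    assume "(s, t) \<in> attU_trans M"
    then obtain p s' s'' where "p \<in> bu_final B" "bu_run B s p s'" "td_run T (att_init T) s' s''"
      "s'' \<in> trees (att_in A)" "gder (ground A (mark s'')) (att_init A, [1]) t"
      unfolding attU_trans_def la_trans_def B_def[symmetric] T_def[symmetric] A_def[symmetric] bu_trans_def
      by (auto simp: td_trans_iff[OF T] att_trans_iff[OF A])
    then show "\<exists>p\<in>bu_final B. \<exists>s' s''. bu_run B s p s' \<and> td_run T (att_init T) s' s'' \<and>
      s'' \<in> trees (att_in A) \<and> gder (ground A (mark s'')) (att_init A, [1]) t" by blast
  next
    assume "\<exists>p\<in>bu_final B. \<exists>s' s''. bu_run B s p s' \<and> td_run T (att_init T) s' s'' \<and>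
      s'' \<in> trees (att_in A) \<and> gder (ground A (mark s'')) (att_init A, [1]) t"
    then obtain p s' s'' where *: "p \<in> bu_final B" "bu_run B s p s'" "td_run T (att_init T) s' s''"
      "s'' \<in> trees (att_in A)" "gder (ground A (mark s'')) (att_init A, [1]) t" by blast
    from bu_run_trees[OF B *(2)] have "s \<in> trees (bu_in B)" "s' \<in> trees (att_in T)" using BT by auto
    with * have "(s, s') \<in> bu_trans B" "(s', s'') \<in> att_trans T" "(s'', t) \<in> att_trans A"
      by (auto simp: bu_trans_def td_trans_iff[OF T] att_trans_iff[OF A])
    then show "(s, t) \<in> attU_trans M"
      unfolding attU_trans_def la_trans_def B_def[symmetric] T_def[symmetric] A_def[symmetric] by blast
  qed
  obtain hL :: "'a tree \<Rightarrow> nat" where hL: "tree_congruence hL" "saturates hL L"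
    using L by (auto simp: recognizable_def)
  define A' where "A' = restrict_range A hL"
  have A': "att A'" unfolding A'_def using A hL(1) by (rule att_restrict_range)
  define Init where "Init = {att_init A} \<times> hL ` L"
  have Init: "Init \<subseteq> syn A'" using A by (auto simp: Init_def A'_def att_def)
  have der_A': "gder (ground A' s) ((\<gamma>, q), w) t \<longleftrightarrow> gder (ground A s) (\<gamma>, w) t \<and> hL t = q" for s \<gamma> q w t
    unfolding A'_def by (rule gder_restrict_range_iff[OF hL(1)])
  obtain X :: "'a set" and dec where X: "finite X" "bij_betw dec X (choice_labels A' Init)"
    using finite_encoding[OF finite_choice_labels[OF A' Init]] by blast
  interpret choice A' Init X dec using A' Init X(2) by unfold_locales
  have inA': "att_in A' = att_in A" and outA': "att_out A' = att_out A" by (simp_all add: A'_def)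
  have D: "datt D" "att D" using datt_D by (auto simp: datt_def)
  then have fin_D: "finite (syn D \<union> inh D)" and \<Gamma>: "ranked_alphabet \<Gamma>" by (auto simp: att_def)
  from finite_imp_inj_to_nat_seg[OF fin_D] obtain e :: "((nat \<times> nat) \<times> (nat \<times> nat, 'a) rules) option \<Rightarrow> nat"
    where e: "inj_on e (syn D \<union> inh D)" by blast
  define D' where "D' = rename_att e D"
  \<comment> \<open>\<open>D\<close> is defined on a labeled tree over \<open>\<Gamma>\<close>
    exactly if the tree is in \<open>Z\<close>; recognizability lets the relabeling test this while
    guessing.\<close>
  define Z where "Z = {u. \<exists>t. gder (ground D (mark u)) (None, [1]) t}"
  have trans_D': "(u, t) \<in> att_trans D' \<longleftrightarrow> u \<in> trees \<Gamma> \<and> gder (ground D (mark u)) (None, [1]) t" for u t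
    unfolding D'_def att_trans_rename_att[OF D(2) e] by (simp add: att_trans_iff[OF D(2)])
  have "recognizable Z" unfolding Z_def by (rule recognizable_productive[OF D(2)])
  then obtain h :: "'a tree \<Rightarrow> nat" where h: "tree_congruence h" "saturates h Z"
    by (auto simp: recognizable_def)
  define R where "R = refinement B T \<Gamma> base h"
  \<comment> \<open>At the root no parent confirms the guessed state of \<open>T\<close>, so
    acceptance demands the initial one.\<close>
  define F where "F = {(p, q, z). p \<in> bu_final B \<and> q = att_init T \<and> z \<in> h ` Z}"
  have finR: "finite R" unfolding R_def by (rule finite_refinement[OF B T BT \<Gamma> h(1)])
  have rank: "\<And>\<sigma> qs q \<gamma>. (\<sigma>, qs, q, \<gamma>) \<in> R \<Longrightarrow> bu_in B \<sigma> = Some (length qs) \<and> \<Gamma> \<gamma> = Some (length qs)"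
    unfolding R_def by (rule refinement_rank[OF B T BT \<Gamma> h(1)])
  have inB: "ranked_alphabet (bu_in B)" using B by (simp add: bu_relabeling_def)
  obtain U :: "(nat, nat, 'a, 'a, 'a) lookaround" where
    U: "lookaround U" "bu_in (la_bu U) = bu_in B" "att_out (la_td U) = \<Gamma>"
    "la_trans U \<subseteq> {(s, u). \<exists>q\<in>F. nrun R s q u}" "Domain (la_trans U) = {s. reach R s \<inter> F \<noteq> {}}"
    by (rule relabeling_uniformization[OF inB \<Gamma> finR rank, where F = F])
  define M' where "M' = \<lparr>attU_la = U, attU_att = D'\<rparr>"
  have D': "datt D'" unfolding D'_def by (rule datt_rename_att[OF D(1) e])
  have base_trees: "map_tree base u \<in> trees (att_in A)" if "u \<in> trees \<Gamma>" for u
    using that by (rule map_tree_trees) (use \<Gamma>D(1) inA' in auto)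
  have la_D: "\<exists>p\<in>bu_final B. \<exists>s'. bu_run B s p s' \<and> td_run T (att_init T) s' (map_tree base u) \<and>
    u \<in> trees \<Gamma> \<and> u \<in> Z" if "(s, u) \<in> la_trans U" for s u
  proof -
    from U(4) that obtain p z where p: "p \<in> bu_final B" "z \<in> h ` Z" "nrun R s (p, att_init T, z) u"
      by (fastforce simp: F_def)
    from nrun_refinementD[OF B T BT \<Gamma> h(1) p(3)[unfolded R_def]] obtain s' where
      s': "bu_run B s p s'" "td_run T (att_init T) s' (map_tree base u)" "u \<in> trees \<Gamma>" "h u = z" by auto
    from p(2) obtain u' where "u' \<in> Z" "h u' = h u" using s'(4) by auto
    then have "u \<in> Z" using h(2) unfolding saturates_def by blast
    with s' p show ?thesis by blast
  qed
  have trans_M': "(s, t) \<in> attU_trans M' \<longleftrightarrow> (\<exists>u. (s, u) \<in> la_trans U \<and> (u, t) \<in> att_trans D')" for s t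
    by (auto simp: attU_trans_def M'_def)
  \<comment> \<open>Every tree that \<open>U\<close> outputs lies in \<open>Z\<close>, so
    \<open>D'\<close> is defined on it and no input is lost in the second stage.\<close>
  have dom: "Domain (attU_trans M') = Domain (la_trans U)"
  proof
    show "Domain (la_trans U) \<subseteq> Domain (attU_trans M')"
    proof
      fix s assume "s \<in> Domain (la_trans U)"
      then obtain u where u: "(s, u) \<in> la_trans U" by blast
      with la_D have "u \<in> trees \<Gamma>" "u \<in> Z" by auto
      then obtain t where "(u, t) \<in> att_trans D'" unfolding Z_def trans_D' by blast
      with u trans_M' show "s \<in> Domain (attU_trans M')" by blast
    qed
  qed (auto simp: trans_M')
  have sound: "(s, t) \<in> attU_trans M \<and> t \<in> L" if "(s, t) \<in> attU_trans M'" for s t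
  proof -
    from that obtain u where u: "(s, u) \<in> la_trans U" "u \<in> trees \<Gamma>" "gder (ground D (mark u)) (None, [1]) t"
      by (auto simp: trans_M' trans_D')
    from D_sound[OF u(2,3)] obtain t' where "gder (ground A (mark (map_tree base u))) (att_init A, [1]) t"
      "hL t = hL t'" "t' \<in> L" by (auto simp: Init_def der_A')
    moreover from this hL(2) have "t \<in> L" unfolding saturates_def by metis
    ultimately show ?thesis using la_D[OF u(1)] base_trees unfolding trans_M by blast
  qed
  have complete: "s \<in> Domain (la_trans U)" if st: "(s, t) \<in> attU_trans M" and t: "t \<in> L" for s t
  proof -
    from st obtain p s' s'' where s: "p \<in> bu_final B" "bu_run B s p s'" "td_run T (att_init T) s' s''"
      "s'' \<in> trees (att_in A)" "gder (ground A (mark s'')) (att_init A, [1]) t" unfolding trans_M by blast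
    have "\<exists>u\<in>trees \<Gamma>. map_tree base u = s'' \<and> (\<exists>t. gder (ground D (mark u)) (None, [1]) t)"
    proof (rule D_complete)
      show "s'' \<in> trees (att_in A')" using s(4) inA' by simp
      show "(att_init A, hL t) \<in> Init" using t by (simp add: Init_def)
      show "gder (ground A' (mark s'')) ((att_init A, hL t), [1]) t" using s(5) by (simp add: der_A')
    qed
    then obtain u where u: "u \<in> trees \<Gamma>" "map_tree base u = s''" "u \<in> Z" unfolding Z_def by blast
    have "nrun R s (p, att_init T, h u) u"
      unfolding R_def using s(2,3) u by (intro nrun_refinementI[OF B T BT \<Gamma> h(1)]) auto
    then have "(p, att_init T, h u) \<in> reach R s" by (auto simp: reach_def)
    moreover have "(p, att_init T, h u) \<in> F" using s(1) u(3) by (simp add: F_def)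
    ultimately show ?thesis unfolding U(5) by blast
  qed
  show thesis
  proof (rule that)
    show "dattU M'"
      using U D' by (auto simp: dattU_def attU_def M'_def datt_def D'_def)
    show "attU_in M' = attU_in M" using U(2) by (simp add: attU_in_def M'_def B_def)
    show "attU_out M' = attU_out M" by (simp add: attU_out_def M'_def D'_def outA' A_def)
    show "attU_trans M' \<subseteq> attU_trans M" "Range (attU_trans M') \<subseteq> L" using sound by auto
    then show "Domain (attU_trans M') = {s. \<exists>t\<in>L. (s, t) \<in> attU_trans M}"
      using complete sound unfolding dom[symmetric] by blast
    \<comment> \<open>The set of reachable states decides membership in the domain, so the subset
      construction itself recognizes it.\<close>
    have "saturates (reach R) (Domain (attU_trans M'))" unfolding dom U(5) by (simp add: saturates_def)
    then show "recognizable (Domain (attU_trans M'))"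
      by (rule recognizableI[OF tree_congruence_reach[OF finR]])
  qed
qed


section \<open>Compositions\<close>

lemma composable_Cons:
  "composable (M # Ms) \<longleftrightarrow> (Ms \<noteq> [] \<longrightarrow> attU_out M = attU_in (hd Ms)) \<and> composable Ms"
proof
  assume *: "composable (M # Ms)"
  have "attU_out M = attU_in (hd Ms)" if "Ms \<noteq> []"
    using *[unfolded composable_def, rule_format, of 0] that by (simp add: hd_conv_nth)
  moreover have "composable Ms" unfolding composable_def
    using *[unfolded composable_def, rule_format, of "Suc _"] by simp
  ultimately show "(Ms \<noteq> [] \<longrightarrow> attU_out M = attU_in (hd Ms)) \<and> composable Ms" by blast
next
  assume *: "(Ms \<noteq> [] \<longrightarrow> attU_out M = attU_in (hd Ms)) \<and> composable Ms"
  show "composable (M # Ms)" unfolding composable_def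
  proof (intro allI impI)
    fix i assume "Suc i < length (M # Ms)"
    with * show "attU_out ((M # Ms) ! i) = attU_in ((M # Ms) ! Suc i)"
      by (cases i) (auto simp: composable_def hd_conv_nth)
  qed
qed

lemma compose_trans_simps:
  "compose_trans [] = Id" "compose_trans (M # Ms) = attU_trans M O compose_trans Ms"
  by (simp_all add: compose_trans_def)

text \<open>Recognizability of the domain belongs to the induction claim because the next factor to
  the left must aim its range at it; the claim on \<open>attU_in\<close> keeps the new factors
  composable.\<close>

lemma compose_uniformization:
  fixes Ms :: "'a :: infinite attU list"
  assumes "\<forall>M\<in>set Ms. attU M" "composable Ms"
  shows "\<exists>Ds. length Ds = length Ms \<and> (\<forall>D\<in>set Ds. dattU D) \<and> composable Ds \<and>
    (Ms \<noteq> [] \<longrightarrow> attU_in (hd Ds) = attU_in (hd Ms)) \<and> compose_trans Ds \<subseteq> compose_trans Ms \<and>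
    Domain (compose_trans Ds) = Domain (compose_trans Ms) \<and> recognizable (Domain (compose_trans Ds))"
  using assms
proof (induction Ms)
  case Nil
  \<comment> \<open>The empty composition is \<open>Id\<close> on all trees of the type, well-ranked
    or not; its domain \<open>UNIV\<close> is recognizable because congruences live on all
    trees.\<close>
  then show ?case by (auto simp: compose_trans_simps recognizable_UNIV)
next
  case (Cons M Ms)
  then obtain Ds where Ds: "length Ds = length Ms" "\<forall>D\<in>set Ds. dattU D" "composable Ds"
    "Ms \<noteq> [] \<longrightarrow> attU_in (hd Ds) = attU_in (hd Ms)" "compose_trans Ds \<subseteq> compose_trans Ms"
    "Domain (compose_trans Ds) = Domain (compose_trans Ms)" "recognizable (Domain (compose_trans Ds))"
    by (auto simp: composable_Cons)
  from Cons.prems have M: "attU M" by simp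
  obtain D where D: "dattU D" "attU_in D = attU_in M"
    "attU_out D = attU_out M" "attU_trans D \<subseteq> attU_trans M" "Range (attU_trans D) \<subseteq> Domain (compose_trans Ds)"
    "Domain (attU_trans D) = {s. \<exists>t\<in>Domain (compose_trans Ds). (s, t) \<in> attU_trans M}"
    "recognizable (Domain (attU_trans D))"
    by (rule attU_uniformization[OF M Ds(7)])
  \<comment> \<open>No output of \<open>D\<close> falls outside the domain of the remaining factors,
    so composing with them keeps the domain.\<close>
  have dom: "Domain (compose_trans (D # Ds)) = Domain (attU_trans D)"
    using D(5) unfolding compose_trans_simps by blast
  moreover have "Domain (attU_trans D) = Domain (compose_trans (M # Ms))"
    unfolding D(6) Ds(6) compose_trans_simps by blast
  moreover have "compose_trans (D # Ds) \<subseteq> compose_trans (M # Ms)"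
    using D(4) Ds(5) unfolding compose_trans_simps by blast
  moreover have "composable (D # Ds)"
    using Cons.prems(2) Ds(1,3,4) D(3) by (auto simp: composable_Cons)
  ultimately show ?case using Ds(1,2) D(1,2,7) by (intro exI[of _ "D # Ds"]) simp
qed

lemma compose_single_valued: "\<forall>M\<in>set Ms. dattU M \<Longrightarrow> single_valued (compose_trans Ms)"
  by (induction Ms) (auto simp: compose_trans_simps intro: single_valued_relcomp dattU_single_valued)

theorem theorem4:
  fixes n :: nat
  assumes "n \<ge> 1"
  shows "ATTU_pow n \<inter> partial_functions = (dATTU_pow n :: ('a::infinite tree \<times> 'a tree) set set)"
proof
  show "dATTU_pow n \<subseteq> ATTU_pow n \<inter> (partial_functions :: ('a tree \<times> 'a tree) set set)"
    unfolding dATTU_pow_def ATTU_pow_def partial_functions_def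
    using compose_single_valued by (fastforce simp: dattU_def)
  show "ATTU_pow n \<inter> partial_functions \<subseteq> (dATTU_pow n :: ('a tree \<times> 'a tree) set set)"
  proof
    fix \<rho> :: "('a tree \<times> 'a tree) set"
    assume "\<rho> \<in> ATTU_pow n \<inter> partial_functions"
    then obtain Ms where Ms: "\<rho> = compose_trans Ms" "length Ms = n" "\<forall>M\<in>set Ms. attU M" "composable Ms"
      "single_valued \<rho>" by (auto simp: ATTU_pow_def partial_functions_def)
    from compose_uniformization[OF Ms(3,4)] obtain Ds where Ds: "length Ds = n" "\<forall>D\<in>set Ds. dattU D"
      "composable Ds" "compose_trans Ds \<subseteq> \<rho>" "Domain (compose_trans Ds) = Domain \<rho>"
      using Ms(1,2) by auto
    \<comment> \<open>A function has no proper restriction with the same domain.\<close>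
    have "\<rho> \<subseteq> compose_trans Ds"
    proof
      fix x assume "x \<in> \<rho>"
      moreover obtain s t where x: "x = (s, t)" by (cases x)
      ultimately obtain t' where "(s, t') \<in> compose_trans Ds" using Ds(5) by blast
      with Ds(4) Ms(5) \<open>x \<in> \<rho>\<close> x show "x \<in> compose_trans Ds" by (auto dest: single_valuedD)
    qed
    with Ds show "\<rho> \<in> dATTU_pow n" unfolding dATTU_pow_def by blast
  qed
qed

end
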